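(* Let $n\ge1$, $d>0$ and $V\in C^\infty(\mathbb{T}^n)$. Given $H:\mathbb{R}^n\to\mathbb{R}$ as specified in each part, let $\overline H_d$ be the viscous effective Hamiltonian associated with $H(p)+V(x)$ and diffusion constant $d$. (1) Suppose that $H\in C^2(\mathbb{R}^n)$, $\sup_{\mathbb{R}^n}\|D^2H\|<+\infty$ and $H$ is superlinear. Then $$\overline H_d(p)\equiv H(p)\ \Longrightarrow\ V\equiv0.$$ (2) Suppose that $H(p)=|p|^2$. If $\overline H_d(p)=|p|^2+o(|p|^2)$ for $p$ in a neighborhood of the origin of $\mathbb{R}^n$ (i.e. as $p\to0$), then $V\equiv0$.
   Context: $\mathbb{T}^n=\mathbb{R}^n/\mathbb{Z}^n$; functions on $\mathbb{T}^n$ are identified with $\mathbb{Z}^n$-periodic functions on $\mathbb{R}^n$. For $d>0$, the viscous effective Hamiltonian $\overline H_d:\mathbb{R}^n\to\mathbb{R}$ associated with $H(p)+V(x)$ is defined as follows: for each $p\in\mathbb{R}^n$, $\overline H_d(p)$ is the unique constant $c$ such that the cell problem $$-d\Delta w+H(p+Dw)+V(x)=c\quad\text{in }\mathbb{T}^n$$ has a ($\mathbb{Z}^n$-periodic) solution $w$. $H$ is superlinear if $H(p)/|p|\to+\infty$ as $|p|\to\infty$. *)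

theory Defs
  imports "HOL-Analysis.Analysis" "HOL-Library.Landau_Symbols"
begin

(* Functions on the torus R^n / Z^n are represented by Z^n-periodic functions on R^n. *)

definition int_periodic :: "(real^'n \<Rightarrow> 'b) \<Rightarrow> bool" where
  "int_periodic f \<longleftrightarrow> (\<forall>x k. (\<forall>i. k $ i \<in> \<int>) \<longrightarrow> f (x + k) = f x)"

(* At points where f is not differentiable, frechet_derivative is arbitrary; the operators below
   are only applied to functions of class C^1 or C^2. *)

definition partial_deriv :: "'n \<Rightarrow> (real^'n \<Rightarrow> real) \<Rightarrow> real^'n \<Rightarrow> real" where
  "partial_deriv i f x = frechet_derivative f (at x) (axis i 1)"

definition gradient :: "(real^'n \<Rightarrow> real) \<Rightarrow> real^'n \<Rightarrow> real^'n" where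
  "gradient f x = (\<chi> i. partial_deriv i f x)"

definition hessian :: "(real^'n \<Rightarrow> real) \<Rightarrow> real^'n \<Rightarrow> real^'n^'n" where
  "hessian f x = (\<chi> i j. partial_deriv i (partial_deriv j f) x)"

definition laplacian :: "(real^'n \<Rightarrow> real) \<Rightarrow> real^'n \<Rightarrow> real" where
  "laplacian f x = (\<Sum>i\<in>UNIV. partial_deriv i (partial_deriv i f) x)"

fun Ck :: "nat \<Rightarrow> (real^'n \<Rightarrow> real) \<Rightarrow> bool" where
  "Ck 0 f \<longleftrightarrow> continuous_on UNIV f"
| "Ck (Suc k) f \<longleftrightarrow> f differentiable_on UNIV \<and> (\<forall>i. Ck k (partial_deriv i f))"

definition Cinfinity :: "(real^'n \<Rightarrow> real) \<Rightarrow> bool" where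
  "Cinfinity f \<longleftrightarrow> (\<forall>k. Ck k f)"

definition superlinear :: "(real^'n \<Rightarrow> real) \<Rightarrow> bool" where
  "superlinear H \<longleftrightarrow> filterlim (\<lambda>p. H p / norm p) at_top at_infinity"

(* Solutions of the cell problem are classical, i.e. of class C^2. *)

definition cell_solution ::
  "real \<Rightarrow> (real^'n \<Rightarrow> real) \<Rightarrow> (real^'n \<Rightarrow> real) \<Rightarrow> real^'n \<Rightarrow> real \<Rightarrow> (real^'n \<Rightarrow> real) \<Rightarrow> bool" where
  "cell_solution d H V p c w \<longleftrightarrow>
     Ck 2 w \<and> int_periodic w \<and>
     (\<forall>x. - d * laplacian w x + H (p + gradient w x) + V x = c)"

(* "Hbar is the viscous effective Hamiltonian": for each p, Hbar p is the unique constant for which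
   the cell problem is solvable. This is a predicate on Hbar rather than a definite description,
   since a definite description would denote an arbitrary value if the cell problem were not
   solvable for exactly one constant. *)

definition viscous_effective_hamiltonian ::
  "real \<Rightarrow> (real^'n \<Rightarrow> real) \<Rightarrow> (real^'n \<Rightarrow> real) \<Rightarrow> (real^'n \<Rightarrow> real) \<Rightarrow> bool" where
  "viscous_effective_hamiltonian d H V Hbar \<longleftrightarrow>
     (\<forall>p. (\<exists>w. cell_solution d H V p (Hbar p) w) \<and>
          (\<forall>c. (\<exists>w. cell_solution d H V p c w) \<longrightarrow> c = Hbar p))"

end

theory Submission imports Defs begin

text \<open>
  Both parts rest on comparison: if \<open>u\<close> and \<open>w\<close> are periodic, then at a maximum of \<open>u - w\<close> the gradients agree
  and \<open>\<Delta>u \<le> \<Delta>w\<close>. So any periodic \<open>u\<close> serves as a test function for the effective Hamiltonian.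

  Part 1. Choose \<open>p\<close> with \<open>DH(p) = \<lambda>\<xi>\<close> and test with \<open>W / \<lambda>\<close>, where \<open>\<xi> \<cdot> DW\<close> approximates \<open>\<integral>V - V\<close>. As
  \<open>\<lambda> \<rightarrow> \<infinity>\<close> this gives \<open>\<integral>V \<ge> 0\<close>. By superlinearity some point \<open>p\<close> of the graph of \<open>H\<close> is strictly
  exposed, with slope \<open>Q\<close> say. Integrating the cell equation at \<open>p\<close> gives
  \<open>\<integral>(H(p + Dw) - H(p) - Q \<cdot> Dw) = - \<integral>V \<le> 0\<close>, and the integrand is positive wherever \<open>Dw \<noteq> 0\<close>. Hence
  \<open>Dw = 0\<close> and \<open>V = 0\<close>.

  Part 2. Comparison gives that the effective Hamiltonian vanishes at \<open>0\<close>. Let \<open>v = w\<^sub>p - w\<^sub>0\<close> and \<open>\<sigma> = exp (- 2 v / d)\<close>. Integrating the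
  equation of \<open>v\<close> against \<open>\<sigma> exp (- 2 w\<^sub>0 / d)\<close> shows that \<open>\<integral>\<sigma>|Dv|\<^sup>2 = o(|p|\<^sup>2) \<integral>\<sigma>\<close>. Testing it with
  \<open>\<sigma> \<partial>\<^sub>iw\<^sub>0\<close> for \<open>p = t e\<^sub>i\<close> then shows that \<open>\<integral>\<sigma>(\<partial>\<^sub>iw\<^sub>0)\<^sup>2 = o(1) \<integral>\<sigma>\<close>. Since \<open>Dv\<close> is small,
  \<open>\<sigma>\<close> is nearly constant as a weight, so \<open>Dw\<^sub>0 = 0\<close> and \<open>V = 0\<close>.
\<close>

subsection \<open>Functions of class C^k\<close>

lemma partial_deriv_eq:
  "(f has_derivative f') (at x) \<Longrightarrow> partial_deriv i f x = f' (axis i 1)"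
  unfolding partial_deriv_def by (metis frechet_derivative_at)

lemma gradient_nth [simp]: "gradient f x $ i = partial_deriv i f x"
  by (simp add: gradient_def)

lemma frechet_derivative_gradient:
  fixes f :: "real^'n \<Rightarrow> real"
  assumes "f differentiable at x"
  shows "frechet_derivative f (at x) h = gradient f x \<bullet> h"
proof -
  interpret F: linear "frechet_derivative f (at x)"
    using assms by (rule linear_frechet_derivative)
  have "frechet_derivative f (at x) h = frechet_derivative f (at x) (\<Sum>i\<in>UNIV. h $ i *s axis i 1)"
    by (simp add: basis_expansion)
  also have "\<dots> = (\<Sum>i\<in>UNIV. h $ i * frechet_derivative f (at x) (axis i 1))"
    by (simp add: F.sum F.scale scalar_mult_eq_scaleR)
  finally show ?thesis
    by (simp add: inner_vec_def partial_deriv_def mult.commute)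
qed

lemma has_derivative_gradient:
  fixes f :: "real^'n \<Rightarrow> real"
  assumes "f differentiable at x"
  shows "(f has_derivative (\<lambda>h. gradient f x \<bullet> h)) (at x)"
  using assms frechet_derivative_works frechet_derivative_gradient[OF assms]
  by (metis (no_types, lifting) ext)

lemma CkD:
  assumes "Ck (Suc k) f"
  shows "f differentiable at x" and "Ck k (partial_deriv i f)"
  using assms by (auto simp: differentiable_on_def)

lemma Ck_Suc_I:
  assumes "\<And>x. (f has_derivative f' x) (at x)" and "\<And>i. Ck k (\<lambda>x. f' x (axis i 1))"
  shows "Ck (Suc k) f"
proof -
  have "partial_deriv i f = (\<lambda>x. f' x (axis i 1))" for i
    using assms(1) partial_deriv_eq by blast
  then show ?thesis
    using assms by (auto simp: differentiable_on_def differentiable_def)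
qed

lemma Ck_lower: "Ck (Suc k) f \<Longrightarrow> Ck k f"
proof (induction k arbitrary: f)
  case 0
  then show ?case by (auto intro: differentiable_imp_continuous_on)
qed (simp only: Ck.simps, blast)

lemma Ck_2: "Ck 2 f \<longleftrightarrow> Ck (Suc 1) f"
  by (simp add: numeral_2_eq_2)

lemma Ck_imp_continuous_on: "Ck k f \<Longrightarrow> continuous_on UNIV f"
  by (induction k arbitrary: f) (auto intro: differentiable_imp_continuous_on)

lemma has_derivative_Ck:
  "Ck (Suc k) f \<Longrightarrow> (f has_derivative (\<lambda>h. gradient f x \<bullet> h)) (at x)"
  by (intro has_derivative_gradient CkD)

lemma gradient_axis [simp]: "gradient f x \<bullet> axis i 1 = partial_deriv i f x"
  by (simp add: inner_axis)

lemma continuous_on_gradient: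
  assumes "Ck (Suc k) f"
  shows "continuous_on UNIV (gradient f)"
  unfolding gradient_def
  by (intro continuous_on_vec_lambda Ck_imp_continuous_on[of k] CkD(2)[OF assms])

lemma continuous_on_laplacian:
  "Ck 2 f \<Longrightarrow> continuous_on UNIV (laplacian f)"
  unfolding laplacian_def by (auto simp: numeral_2_eq_2 intro!: continuous_on_sum)

lemma Ck_const [simp, intro]: "Ck k (\<lambda>x. c)"
proof (induction k arbitrary: c)
  case (Suc k)
  show ?case by (rule Ck_Suc_I[where f'="\<lambda>_ _. 0"]) (auto intro: Suc)
qed simp

lemma Ck_add: "Ck k f \<Longrightarrow> Ck k g \<Longrightarrow> Ck k (\<lambda>x. f x + g x)"
proof (induction k arbitrary: f g)
  case 0
  then show ?case by (auto intro: continuous_intros)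
next
  case (Suc k)
  show ?case
    by (rule Ck_Suc_I[OF has_derivative_add[OF has_derivative_Ck[OF Suc.prems(1)] has_derivative_Ck[OF Suc.prems(2)]]])
      (use Suc in \<open>simp add: CkD(2)\<close>)
qed

lemma Ck_mult: "Ck k f \<Longrightarrow> Ck k g \<Longrightarrow> Ck k (\<lambda>x. f x * g x)"
proof (induction k arbitrary: f g)
  case 0
  then show ?case by (auto intro: continuous_intros)
next
  case (Suc k)
  show ?case
    by (rule Ck_Suc_I[OF has_derivative_mult[OF has_derivative_Ck[OF Suc.prems(1)] has_derivative_Ck[OF Suc.prems(2)]]])
      (use Suc in \<open>simp add: CkD(2) Ck_add Ck_lower del: Ck.simps\<close>)
qed

lemma Ck_cmult: "Ck k f \<Longrightarrow> Ck k (\<lambda>x. c * f x)"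
  by (intro Ck_mult Ck_const)

lemma Ck_diff: "Ck k f \<Longrightarrow> Ck k g \<Longrightarrow> Ck k (\<lambda>x. f x - g x)"
  using Ck_add[OF _ Ck_cmult[of k g "-1"]] by simp

lemma Ck_exp: "Ck k f \<Longrightarrow> Ck k (\<lambda>x. exp (f x))"
proof (induction k arbitrary: f)
  case 0
  then show ?case by (auto intro: continuous_intros)
next
  case (Suc k)
  show ?case
    by (rule Ck_Suc_I[OF has_derivative_exp[OF has_derivative_Ck[OF Suc.prems(1)]]])
      (use Suc in \<open>simp add: CkD(2) Ck_mult Ck_lower del: Ck.simps\<close>)
qed

section \<open>Calculus rules for partial derivatives, gradients and Laplacians\<close>

lemma partial_deriv_add:
  "Ck (Suc k) f \<Longrightarrow> Ck (Suc k) g \<Longrightarrow>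
    partial_deriv i (\<lambda>x. f x + g x) x = partial_deriv i f x + partial_deriv i g x"
  by (subst partial_deriv_eq[OF has_derivative_add[OF has_derivative_Ck has_derivative_Ck]])
    (auto simp del: Ck.simps)

lemma partial_deriv_diff:
  "Ck (Suc k) f \<Longrightarrow> Ck (Suc k) g \<Longrightarrow>
    partial_deriv i (\<lambda>x. f x - g x) x = partial_deriv i f x - partial_deriv i g x"
  by (subst partial_deriv_eq[OF has_derivative_diff[OF has_derivative_Ck has_derivative_Ck]])
    (auto simp del: Ck.simps)

lemma partial_deriv_mult:
  "Ck (Suc k) f \<Longrightarrow> Ck (Suc k) g \<Longrightarrow>
    partial_deriv i (\<lambda>x. f x * g x) x = f x * partial_deriv i g x + partial_deriv i f x * g x"
  by (subst partial_deriv_eq[OF has_derivative_mult[OF has_derivative_Ck has_derivative_Ck]])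
    (auto simp del: Ck.simps)

lemma partial_deriv_cmult:
  "Ck (Suc k) f \<Longrightarrow> partial_deriv i (\<lambda>x. c * f x) x = c * partial_deriv i f x"
  by (subst partial_deriv_eq[OF has_derivative_mult_right[OF has_derivative_Ck]])
    (auto simp del: Ck.simps)

lemma partial_deriv_exp:
  "Ck (Suc k) f \<Longrightarrow> partial_deriv i (\<lambda>x. exp (f x)) x = exp (f x) * partial_deriv i f x"
  by (subst partial_deriv_eq[OF has_derivative_exp[OF has_derivative_Ck]])
    (auto simp del: Ck.simps)

lemma partial_deriv_const: "partial_deriv i (\<lambda>x. c) x = 0"
  by (subst partial_deriv_eq[OF has_derivative_const]) simp

lemma gradient_add:
  "Ck (Suc k) f \<Longrightarrow> Ck (Suc k) g \<Longrightarrow> gradient (\<lambda>x. f x + g x) x = gradient f x + gradient g x"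
  unfolding vec_eq_iff by (simp add: partial_deriv_add del: Ck.simps)

lemma gradient_diff:
  "Ck (Suc k) f \<Longrightarrow> Ck (Suc k) g \<Longrightarrow> gradient (\<lambda>x. f x - g x) x = gradient f x - gradient g x"
  unfolding vec_eq_iff by (simp add: partial_deriv_diff del: Ck.simps)

lemma gradient_cmult:
  "Ck (Suc k) f \<Longrightarrow> gradient (\<lambda>x. c * f x) x = c *\<^sub>R gradient f x"
  unfolding vec_eq_iff by (simp add: partial_deriv_cmult del: Ck.simps)

lemma laplacian_diff:
  assumes "Ck 2 f" "Ck 2 g"
  shows "laplacian (\<lambda>x. f x - g x) x = laplacian f x - laplacian g x"
proof -
  have "partial_deriv i (\<lambda>x. f x - g x) = (\<lambda>x. partial_deriv i f x - partial_deriv i g x)" for i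
    using assms by (auto simp: Ck_2 partial_deriv_diff simp del: Ck.simps)
  then show ?thesis
    using assms by (simp add: Ck_2 laplacian_def partial_deriv_diff[of 0] CkD(2) sum_subtractf del: Ck.simps)
qed

lemma laplacian_cmult:
  assumes "Ck 2 f"
  shows "laplacian (\<lambda>x. c * f x) x = c * laplacian f x"
proof -
  have "partial_deriv i (\<lambda>x. c * f x) = (\<lambda>x. c * partial_deriv i f x)" for i
    using assms by (auto simp: Ck_2 partial_deriv_cmult simp del: Ck.simps)
  then show ?thesis
    using assms by (simp add: Ck_2 laplacian_def partial_deriv_cmult[of 0] CkD(2) sum_distrib_left del: Ck.simps)
qed

lemma laplacian_eq_0_of_gradient:
  assumes "\<And>x. gradient w x = 0"
  shows "laplacian w x = 0"
proof -
  have "partial_deriv i w = (\<lambda>_. 0)" for i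
    using assms by (metis ext gradient_nth zero_index)
  then show ?thesis
    by (simp add: laplacian_def partial_deriv_const)
qed

lemma has_real_derivative_along:
  assumes "Ck (Suc k) f"
  shows "((\<lambda>r. f (x + r *\<^sub>R v)) has_real_derivative gradient f (x + r *\<^sub>R v) \<bullet> v) (at r)"
proof -
  have "((\<lambda>r. f (x + r *\<^sub>R v)) has_derivative (\<lambda>h. gradient f (x + r *\<^sub>R v) \<bullet> (h *\<^sub>R v))) (at r)"
    by (rule has_derivative_compose[OF _ has_derivative_Ck[OF assms], of "\<lambda>r. x + r *\<^sub>R v" "\<lambda>h. h *\<^sub>R v"])
      (auto intro!: derivative_eq_intros)
  then show ?thesis
    by (simp add: has_field_derivative_def mult_commute_abs)
qed

subsection \<open>Periodic functions\<close>

lemma int_periodicD: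
  "int_periodic f \<Longrightarrow> (\<And>i. k $ i \<in> \<int>) \<Longrightarrow> f (x + k) = f x"
  by (simp add: int_periodic_def)

lemma int_periodic_axis: "int_periodic f \<Longrightarrow> f (x + axis i 1) = f x"
  by (rule int_periodicD) (auto simp: axis_def)

text \<open>Integer translations carry derivatives at \<open>x\<close> to derivatives at
  \<open>x + k\<close> and back. Both points thus have the same set of derivatives, and
  \<open>frechet_derivative\<close>, a choice from that set, agrees at them even where
  \<open>f\<close> is not differentiable.\<close>

lemma int_periodic_partial_deriv:
  assumes "int_periodic f"
  shows "int_periodic (partial_deriv i f)"
proof -
  have shift: "(f has_derivative f') (at (x + k))"
    if "(f has_derivative f') (at x)" "\<And>i. k $ i \<in> \<int>" for f' x k
  proof -
    have "(\<lambda>y. f (y - k)) = f"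
      using int_periodicD[OF assms, of "- k"] that(2) by simp
    moreover have "((\<lambda>y. y - k) has_derivative (\<lambda>h. h)) (at (x + k))"
      by (auto intro!: derivative_eq_intros)
    then have "((\<lambda>y. f (y - k)) has_derivative f') (at (x + k))"
      using that(1) has_derivative_compose[of "\<lambda>y. y - k" "\<lambda>h. h" "x + k" UNIV f f'] by simp
    ultimately show ?thesis
      by simp
  qed
  have "(f has_derivative f') (at (x + k)) \<longleftrightarrow> (f has_derivative f') (at x)"
    if "\<And>i. k $ i \<in> \<int>" for f' x k
    using shift[of f' x k] shift[of f' "x + k" "- k"] that by auto
  then show ?thesis
    by (simp add: int_periodic_def partial_deriv_def frechet_derivative_def)
qed

lemma int_periodic_gradient: "int_periodic f \<Longrightarrow> int_periodic (gradient f)"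
  using int_periodic_partial_deriv[of f] by (simp add: int_periodic_def vec_eq_iff)

lemma int_periodic_laplacian: "int_periodic f \<Longrightarrow> int_periodic (laplacian f)"
  using int_periodic_partial_deriv[of "partial_deriv _ f", OF int_periodic_partial_deriv[of f]]
  by (simp add: int_periodic_def laplacian_def)

lemma periodic_reduce:
  fixes x :: "real^'n"
  assumes "int_periodic f"
  obtains y where "y \<in> cbox 0 1" "f y = f x"
proof
  show "f (\<chi> i. frac (x $ i)) = f x"
  proof -
    have "x = (\<chi> i. frac (x $ i)) + (\<chi> i. of_int \<lfloor>x $ i\<rfloor>)"
      by (simp add: vec_eq_iff frac_def)
    then show ?thesis
      using int_periodicD[OF assms, of "\<chi> i. of_int \<lfloor>x $ i\<rfloor>" "\<chi> i. frac (x $ i)"] by simp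
  qed
  show "(\<chi> i. frac (x $ i)) \<in> cbox 0 (1 :: real^'n)"
    by (auto simp: mem_box_cart frac_lt_1 less_imp_le)
qed

lemma periodic_attains_sup:
  fixes f :: "real^'n \<Rightarrow> real"
  assumes "continuous_on UNIV f" "int_periodic f"
  obtains x where "\<And>y. f y \<le> f x"
proof -
  have "cbox 0 (1 :: real^'n) \<noteq> {}"
    by (simp add: interval_ne_empty_cart)
  then obtain x where x: "\<And>y. y \<in> cbox 0 1 \<Longrightarrow> f y \<le> f x"
    using continuous_attains_sup[OF compact_cbox, of "0 :: real^'n" 1 f] assms(1)
    by (meson continuous_on_subset subset_UNIV)
  show thesis
    by (rule that[of x]) (metis periodic_reduce[OF assms(2)] x)
qed

lemma periodic_bounded:
  fixes f :: "real^'n \<Rightarrow> 'b :: real_normed_vector"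
  assumes "continuous_on UNIV f" "int_periodic f"
  obtains B where "B > 0" "\<And>x. norm (f x) \<le> B"
proof -
  have "continuous_on UNIV (\<lambda>x. norm (f x))" "int_periodic (\<lambda>x. norm (f x))"
    using assms by (auto intro: continuous_intros simp: int_periodic_def)
  then obtain x where x: "\<And>y. norm (f y) \<le> norm (f x)"
    using periodic_attains_sup by blast
  show thesis
    by (rule that[of "norm (f x) + 1"]) (auto simp: add_nonneg_pos intro: order_trans[OF x])
qed

section \<open>Maximum principle and comparison\<close>

text \<open>If a pure second derivative were positive at a maximum, the first derivative, which
  vanishes there, would be positive just beyond it. By the mean value theorem \<open>z\<close> would
  then exceed its maximum.\<close>

lemma partial_deriv_max:
  fixes z :: "real^'n \<Rightarrow> real"
  assumes "Ck 2 z" and max: "\<And>y. z y \<le> z x"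
  shows "gradient z x = 0" and "partial_deriv i (partial_deriv i z) x \<le> 0"
proof -
  have z: "Ck (Suc 1) z" and z': "Ck (Suc 0) (partial_deriv i z)" for i
    using assms(1) by (simp_all add: Ck_2)
  have "(\<lambda>h. gradient z x \<bullet> h) = (\<lambda>h. 0)"
    by (rule differential_zero_maxmin[OF _ _ has_derivative_Ck[OF z], of _ UNIV]) (use max in auto)
  then show grad: "gradient z x = 0"
    by (meson inner_eq_zero_iff)
  show "partial_deriv i (partial_deriv i z) x \<le> 0"
  proof (rule ccontr)
    assume pos: "\<not> partial_deriv i (partial_deriv i z) x \<le> 0"
    let ?g = "\<lambda>r. partial_deriv i z (x + r *\<^sub>R axis i 1)"
    have "(?g has_real_derivative partial_deriv i (partial_deriv i z) x) (at 0)"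
      using has_real_derivative_along[OF z', where r=0 and v="axis i 1"] by simp
    then obtain e where e: "e > 0" "\<And>h. 0 < h \<Longrightarrow> h < e \<Longrightarrow> ?g 0 < ?g h"
      using DERIV_pos_inc_right[of ?g _ 0] pos by force
    have g0: "?g 0 = 0"
      using grad by (metis add.right_neutral gradient_nth scale_zero_left zero_index)
    have "\<exists>r. 0 < r \<and> r < e/2 \<and>
        z (x + (e/2) *\<^sub>R axis i 1) - z (x + 0 *\<^sub>R axis i 1) = (e/2 - 0) * ?g r"
      by (rule MVT2) (use e has_real_derivative_along[OF z, where v="axis i 1"] in auto)
    then obtain r where r: "0 < r" "r < e/2"
        "z (x + (e/2) *\<^sub>R axis i 1) - z (x + 0 *\<^sub>R axis i 1) = (e/2 - 0) * ?g r"
      by blast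
    have "?g r > 0"
      using e(2)[of r] r e(1) g0 by simp
    then have "(e/2 - 0) * ?g r > 0"
      using e(1) by simp
    with r(3) max[of "x + (e/2) *\<^sub>R axis i 1"] show False
      by simp
  qed
qed

text \<open>The point is a maximum of \<open>u - w\<close>. Evaluating an equation there turns any
  periodic \<open>u\<close> into a bound on the constant belonging to \<open>w\<close>.\<close>

lemma periodic_comparison:
  assumes "Ck 2 u" "int_periodic u" "Ck 2 w" "int_periodic w"
  obtains x where "gradient u x = gradient w x" "laplacian u x \<le> laplacian w x"
proof -
  let ?z = "\<lambda>x. u x - w x"
  have z: "Ck 2 ?z"
    using assms Ck_diff by blast
  have "int_periodic ?z"
    using assms by (simp add: int_periodic_def)
  then obtain x where x: "\<And>y. ?z y \<le> ?z x"
    using periodic_attains_sup[OF Ck_imp_continuous_on[OF z]] by blast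
  have "gradient u x - gradient w x = 0"
    using partial_deriv_max(1)[of ?z x, OF z x] gradient_diff[of 1 u w x] assms
    by (simp add: Ck_2 del: Ck.simps)
  moreover have "laplacian ?z x \<le> 0"
    unfolding laplacian_def by (intro sum_nonpos partial_deriv_max(2)[of ?z x, OF z x])
  then have "laplacian u x \<le> laplacian w x"
    using laplacian_diff[OF assms(1,3)] by simp
  ultimately show thesis
    using that by simp
qed

subsection \<open>Averages along coordinate directions\<close>

text \<open>Two kernels matter: \<open>1\<close> gives the average over a period in direction
  \<open>i\<close>, and \<open>1 - s\<close> gives the corrector for that average.\<close>

definition line_avg :: "(real \<Rightarrow> real) \<Rightarrow> 'n \<Rightarrow> (real^'n \<Rightarrow> real) \<Rightarrow> real^'n \<Rightarrow> real" where
  "line_avg k i f x = integral {0..1} (\<lambda>s. k s * f (x + s *\<^sub>R axis i 1))"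

lemma continuous_on_line:
  fixes f :: "real^'n \<Rightarrow> real"
  assumes "continuous_on UNIV f"
  shows "continuous_on S (\<lambda>s. f (x + s *\<^sub>R axis i 1))"
  by (rule continuous_on_compose2[OF assms]) (auto intro!: continuous_intros)

lemma line_avg_integrable:
  fixes f :: "real^'n \<Rightarrow> real"
  assumes "continuous_on {0..1} k" "continuous_on UNIV f"
  shows "(\<lambda>s. k s * f (x + s *\<^sub>R axis i 1)) integrable_on {0..1}"
  by (intro integrable_continuous_real continuous_intros continuous_on_line assms)

lemma continuous_on_line_avg:
  assumes "continuous_on {0..1} k" "continuous_on UNIV f"
  shows "continuous_on UNIV (line_avg k i f)"
  unfolding line_avg_def cbox_interval[symmetric]
  by (intro integral_continuous_on_param)
    (auto simp: split_beta intro!: continuous_intros continuous_on_compose2[OF assms(1)]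
      continuous_on_compose2[OF assms(2)])

text \<open>Differentiation under the integral sign. The Leibniz rule yields an integral of bounded
  linear maps, which is then evaluated at \<open>h\<close> inside the integral.\<close>

lemma has_derivative_line_avg:
  fixes f :: "real^'n \<Rightarrow> real"
  assumes k: "continuous_on {0..1} k" and f: "Ck (Suc m) f"
  shows "(line_avg k i f has_derivative
    (\<lambda>h. integral {0..1} (\<lambda>s. k s * (gradient f (x + s *\<^sub>R axis i 1) \<bullet> h)))) (at x)"
proof -
  note g = continuous_on_gradient[OF f]
  let ?G = "\<lambda>y t. k t *\<^sub>R blinfun_inner_right (gradient f (y + t *\<^sub>R axis i 1))"
  have cont: "continuous_on (UNIV \<times> cbox 0 (1::real)) (\<lambda>(y, t). ?G y t)"
    by (auto simp: split_beta intro!: continuous_intros continuous_on_compose2[OF k]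
      continuous_on_compose2[OF g] bounded_linear.continuous_on[OF bounded_linear_blinfun_inner_right])
  have "((\<lambda>y. integral (cbox 0 1) (\<lambda>s. k s * f (y + s *\<^sub>R axis i 1)))
    has_derivative blinfun_apply (integral (cbox 0 1) (?G x))) (at x within UNIV)"
  proof (rule leibniz_rule[OF _ _ cont])
    fix y t
    have "((\<lambda>y. f (y + t *\<^sub>R axis i 1)) has_derivative
        (\<lambda>h. gradient f (y + t *\<^sub>R axis i 1) \<bullet> h)) (at y)"
      by (rule has_derivative_compose[OF _ has_derivative_Ck[OF f], of "\<lambda>y. y + t *\<^sub>R axis i 1" "\<lambda>h. h"])
        (auto intro!: derivative_eq_intros)
    then show "((\<lambda>y. k t * f (y + t *\<^sub>R axis i 1)) has_derivative blinfun_apply (?G y t)) (at y within UNIV)"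
      by (auto intro!: derivative_eq_intros simp: scaleR_blinfun.rep_eq)
  qed (use line_avg_integrable[OF k Ck_imp_continuous_on[OF f]] in auto)
  moreover have "blinfun_apply (integral (cbox 0 1) (?G x)) =
      (\<lambda>h. integral {0..1} (\<lambda>s. k s * (gradient f (x + s *\<^sub>R axis i 1) \<bullet> h)))"
  proof
    fix h
    have "?G x integrable_on cbox 0 1"
      by (intro integrable_continuous continuous_on_compose2[OF cont, of _ "\<lambda>t. (x, t)", simplified]
          continuous_intros)
        auto
    then show "blinfun_apply (integral (cbox 0 1) (?G x)) h =
        integral {0..1} (\<lambda>s. k s * (gradient f (x + s *\<^sub>R axis i 1) \<bullet> h))"
      by (simp add: blinfun_apply_integral scaleR_blinfun.rep_eq)
  qed
  ultimately show ?thesis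
    by (simp add: line_avg_def[abs_def])
qed

lemma partial_deriv_line_avg:
  assumes "continuous_on {0..1} k" "Ck (Suc m) f"
  shows "partial_deriv j (line_avg k i f) = line_avg k i (partial_deriv j f)"
  by (rule ext) (simp add: partial_deriv_eq[OF has_derivative_line_avg[OF assms]] line_avg_def)

lemma Ck_line_avg:
  assumes "continuous_on {0..1} k" "Ck m f"
  shows "Ck m (line_avg k i f)"
  using assms(2)
proof (induction m arbitrary: f)
  case 0
  then show ?case using continuous_on_line_avg[OF assms(1)] by simp
next
  case (Suc m)
  show ?case
    by (rule Ck_Suc_I[OF has_derivative_line_avg[OF assms(1) Suc.prems]])
      (use Suc.IH[OF CkD(2)[OF Suc.prems]] in \<open>simp add: line_avg_def[abs_def] del: Ck.simps\<close>)
qed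

lemma int_periodic_line_avg:
  assumes "int_periodic f"
  shows "int_periodic (line_avg k i f)"
proof -
  have "f (x + y + s *\<^sub>R axis i 1) = f (x + s *\<^sub>R axis i 1)" if "\<forall>i. y $ i \<in> \<int>" for x y s
    using int_periodicD[OF assms, of y "x + s *\<^sub>R axis i 1"] that by (simp add: ac_simps)
  then show ?thesis
    by (simp add: int_periodic_def line_avg_def)
qed

lemma line_avg_add:
  "continuous_on {0..1} k \<Longrightarrow> continuous_on UNIV f \<Longrightarrow> continuous_on UNIV g \<Longrightarrow>
    line_avg k i (\<lambda>x. f x + g x) = (\<lambda>x. line_avg k i f x + line_avg k i g x)"
  by (rule ext) (simp add: line_avg_def distrib_left integral_add line_avg_integrable)

lemma line_avg_cmult: "line_avg k i (\<lambda>x. c * f x) = (\<lambda>x. c * line_avg k i f x)"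
  unfolding line_avg_def by (subst integral_mult_right[symmetric]) (simp add: mult.left_commute)

lemma line_avg_mono:
  assumes "continuous_on UNIV f" "continuous_on UNIV g" "\<And>x. f x \<le> g x"
  shows "line_avg (\<lambda>_. 1) i f x \<le> line_avg (\<lambda>_. 1) i g x"
  unfolding line_avg_def
  by (intro integral_le line_avg_integrable assms) (auto simp: assms)

lemma line_avg_const: "line_avg (\<lambda>_. 1) i (\<lambda>_. c) = (\<lambda>_. c)"
  by (simp add: line_avg_def[abs_def])

lemma line_avg_partial_deriv:
  assumes "Ck (Suc m) f" "int_periodic f"
  shows "line_avg (\<lambda>_. 1) i (partial_deriv i f) x = 0"
proof -
  have "((\<lambda>s. partial_deriv i f (x + s *\<^sub>R axis i 1)) has_integral
      f (x + 1 *\<^sub>R axis i 1) - f (x + 0 *\<^sub>R axis i 1)) {0..1}"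
    using has_real_derivative_along[OF assms(1), of x "axis i 1"]
    by (intro fundamental_theorem_of_calculus)
      (auto simp: has_real_derivative_iff_has_vector_derivative[symmetric] intro: has_field_derivative_at_within)
  then show ?thesis
    using int_periodic_axis[OF assms(2)] by (simp add: line_avg_def integral_unique)
qed

text \<open>The weight \<open>1 - s\<close> turns \<open>line_avg\<close> into a periodic primitive of \<open>avg f - f\<close> in direction \<open>i\<close>.\<close>

lemma line_avg_primitive:
  assumes f: "Ck (Suc m) f"
  shows "partial_deriv i (line_avg (\<lambda>s. 1 - s) i f) x = line_avg (\<lambda>_. 1) i f x - f x"
proof -
  let ?y = "\<lambda>s. x + s *\<^sub>R axis i 1"
  have cont: "continuous_on UNIV f" "continuous_on UNIV (partial_deriv i f)"
    using f Ck_imp_continuous_on CkD(2) by blast+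
  \<comment> \<open>Integration by parts in \<open>s\<close>: the weight is 0 at
    \<open>s = 1\<close> and 1 at \<open>s = 0\<close>, so the only boundary term is
    \<open>- f x\<close>.\<close>
  have "((\<lambda>s. (1 - s) * f (?y s)) has_real_derivative
      (1 - s) * partial_deriv i f (?y s) - f (?y s)) (at s)" for s
    using has_real_derivative_along[OF f, of x "axis i 1" s]
    by (auto intro!: derivative_eq_intros)
  then have "((\<lambda>s. (1 - s) * partial_deriv i f (?y s) - f (?y s)) has_integral
      (1 - 1) * f (?y 1) - (1 - 0) * f (?y 0)) {0..1}"
    by (intro fundamental_theorem_of_calculus)
      (auto simp: has_real_derivative_iff_has_vector_derivative[symmetric] intro: has_field_derivative_at_within)
  moreover have "integral {0..1} (\<lambda>s. (1 - s) * partial_deriv i f (?y s) - f (?y s)) =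
      line_avg (\<lambda>s. 1 - s) i (partial_deriv i f) x - line_avg (\<lambda>_. 1) i f x"
    unfolding line_avg_def
    by (subst integral_diff)
      (auto intro!: line_avg_integrable integrable_continuous_real continuous_on_line cont continuous_intros)
  ultimately have "line_avg (\<lambda>s. 1 - s) i (partial_deriv i f) x - line_avg (\<lambda>_. 1) i f x = - f x"
    by (simp add: integral_unique)
  then show ?thesis
    using partial_deriv_line_avg[OF _ f, of "\<lambda>s. 1 - s" i i] by (simp add: continuous_intros)
qed

subsection \<open>The mean over the torus\<close>

abbreviation iter_avg :: "'n list \<Rightarrow> (real^'n \<Rightarrow> real) \<Rightarrow> real^'n \<Rightarrow> real" where
  "iter_avg L f \<equiv> foldr (line_avg (\<lambda>_. 1)) L f"

lemma Ck_iter_avg: "Ck m f \<Longrightarrow> Ck m (iter_avg L f)"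
  by (induction L) (auto intro: Ck_line_avg)

lemma continuous_on_iter_avg: "continuous_on UNIV f \<Longrightarrow> continuous_on UNIV (iter_avg L f)"
  using Ck_iter_avg[of 0] by simp

lemma int_periodic_iter_avg: "int_periodic f \<Longrightarrow> int_periodic (iter_avg L f)"
  by (induction L) (auto intro: int_periodic_line_avg)

lemma partial_deriv_iter_avg:
  "Ck (Suc m) f \<Longrightarrow> partial_deriv j (iter_avg L f) = iter_avg L (partial_deriv j f)"
proof (induction L)
  case (Cons i L)
  then show ?case
    using partial_deriv_line_avg[OF _ Ck_iter_avg[OF Cons.prems], of "\<lambda>_. 1"] by simp
qed simp

text \<open>Differentiation commutes with each average, so the derivative can be moved inward to the
  average in direction \<open>j\<close>, where it integrates to 0 over a period.\<close>

lemma partial_deriv_iter_avg_eq_0: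
  assumes "Ck (Suc m) f" "int_periodic f" "j \<in> set L"
  shows "partial_deriv j (iter_avg L f) x = 0"
  using assms(3)
proof (induction L arbitrary: x)
  case (Cons i L)
  have C: "Ck (Suc m) (iter_avg L f)"
    using assms(1) by (rule Ck_iter_avg)
  have eq: "partial_deriv j (iter_avg (i # L) f) = line_avg (\<lambda>_. 1) i (partial_deriv j (iter_avg L f))"
    using partial_deriv_line_avg[OF _ C, of "\<lambda>_. 1"] by simp
  show ?case
  proof (cases "j = i")
    case True
    show ?thesis
      unfolding eq unfolding True by (rule line_avg_partial_deriv[OF C int_periodic_iter_avg[OF assms(2)]])
  next
    case False
    then have "partial_deriv j (iter_avg L f) = (\<lambda>_. 0)"
      using Cons by auto
    then show ?thesis
      unfolding eq by (simp add: line_avg_const)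
  qed
qed simp

lemma iter_avg_add:
  "continuous_on UNIV f \<Longrightarrow> continuous_on UNIV g \<Longrightarrow>
    iter_avg L (\<lambda>x. f x + g x) = (\<lambda>x. iter_avg L f x + iter_avg L g x)"
  by (induction L) (simp_all add: line_avg_add continuous_on_iter_avg)

lemma iter_avg_cmult: "iter_avg L (\<lambda>x. c * f x) = (\<lambda>x. c * iter_avg L f x)"
  by (induction L) (simp_all add: line_avg_cmult)

lemma iter_avg_const: "iter_avg L (\<lambda>_. c) = (\<lambda>_. c)"
  by (induction L) (simp_all add: line_avg_const)

lemma iter_avg_mono:
  "continuous_on UNIV f \<Longrightarrow> continuous_on UNIV g \<Longrightarrow> (\<And>x. f x \<le> g x) \<Longrightarrow> iter_avg L f x \<le> iter_avg L g x"
  by (induction L arbitrary: x) (simp_all add: line_avg_mono continuous_on_iter_avg)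

lemma line_avg_eq_0D:
  assumes "continuous_on UNIV f" "\<And>x. f x \<ge> 0" "line_avg (\<lambda>_. 1) i f x = 0" "s \<in> {0..1}"
  shows "f (x + s *\<^sub>R axis i 1) = 0"
proof -
  have "(\<lambda>s. f (x + s *\<^sub>R axis i 1)) integrable_on {0..1}"
    using line_avg_integrable[OF _ assms(1), of "\<lambda>_. 1"] by simp
  then have "((\<lambda>s. f (x + s *\<^sub>R axis i 1)) has_integral 0) (cbox 0 1)"
    using assms(3) by (simp add: line_avg_def has_integral_integral)
  then show ?thesis
    by (rule has_integral_0_cbox_imp_0[rotated 2]) (use assms in \<open>auto intro: continuous_on_line\<close>)
qed

text \<open>The averages are peeled off from the outside. Each is a vanishing integral of a
  continuous nonnegative function, which fixes one more coordinate of the shift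
  \<open>s\<close>.\<close>

lemma iter_avg_eq_0D:
  assumes f: "continuous_on UNIV f" "\<And>x. f x \<ge> 0"
    and "distinct L" "iter_avg L f x = 0" "\<And>j. s $ j \<in> {0..1}" "\<And>j. j \<notin> set L \<Longrightarrow> s $ j = 0"
  shows "f (x + s) = 0"
  using assms(3-)
proof (induction L arbitrary: x s)
  case Nil
  then have "s = 0" by (simp add: vec_eq_iff)
  then show ?case using Nil by simp
next
  case (Cons i L)
  let ?r = "\<chi> j. if j = i then 0 else s $ j"
  have "iter_avg L f y \<ge> 0" for y
    using iter_avg_mono[of "\<lambda>_. 0" f L y] f by (simp add: iter_avg_const)
  then have "iter_avg L f (x + (s $ i) *\<^sub>R axis i 1) = 0"
    using Cons.prems by (intro line_avg_eq_0D[OF continuous_on_iter_avg[OF f(1)]]) auto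
  then have "f (x + (s $ i) *\<^sub>R axis i 1 + ?r) = 0"
    by (rule Cons.IH[rotated]) (use Cons.prems in auto)
  moreover have "s = (s $ i) *\<^sub>R axis i 1 + ?r"
    by (auto simp: vec_eq_iff axis_def)
  ultimately show ?case
    by (metis add.assoc)
qed

definition coords :: "'n::finite list" where
  "coords = (SOME L. distinct L \<and> set L = UNIV)"

lemma coords: "distinct coords" "set coords = UNIV"
  using someI_ex[OF finite_distinct_list[of "UNIV :: 'n::finite set"]]
  by (auto simp: coords_def conj_commute)

text \<open>The integral over the unit cube, as an iterated integral based at 0. In this form
  integration by parts reduces to one variable, and the intermediate averages are available for
  building correctors.\<close>

definition torus_mean :: "(real^'n \<Rightarrow> real) \<Rightarrow> real" where
  "torus_mean f = iter_avg coords f 0"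

lemma torus_mean_add:
  "continuous_on UNIV f \<Longrightarrow> continuous_on UNIV g \<Longrightarrow>
    torus_mean (\<lambda>x. f x + g x) = torus_mean f + torus_mean g"
  by (simp add: torus_mean_def iter_avg_add)

lemma torus_mean_cmult: "torus_mean (\<lambda>x. c * f x) = c * torus_mean f"
  by (simp add: torus_mean_def iter_avg_cmult)

lemma torus_mean_const [simp]: "torus_mean (\<lambda>_. c) = c"
  by (simp add: torus_mean_def iter_avg_const)

lemma torus_mean_diff:
  "continuous_on UNIV f \<Longrightarrow> continuous_on UNIV g \<Longrightarrow>
    torus_mean (\<lambda>x. f x - g x) = torus_mean f - torus_mean g"
  using torus_mean_add[of f "\<lambda>x. -1 * g x"] torus_mean_cmult[of "-1" g]
  by (simp add: continuous_on_minus)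

lemma torus_mean_mono:
  "continuous_on UNIV f \<Longrightarrow> continuous_on UNIV g \<Longrightarrow> (\<And>x. f x \<le> g x) \<Longrightarrow> torus_mean f \<le> torus_mean g"
  by (simp add: torus_mean_def iter_avg_mono)

lemma torus_mean_sum:
  "finite A \<Longrightarrow> (\<And>i. i \<in> A \<Longrightarrow> continuous_on UNIV (f i)) \<Longrightarrow>
    torus_mean (\<lambda>x. \<Sum>i\<in>A. f i x) = (\<Sum>i\<in>A. torus_mean (f i))"
  by (induction A rule: finite_induct) (simp_all add: torus_mean_add continuous_on_sum)

lemma torus_mean_partial_deriv:
  assumes "Ck (Suc m) f" "int_periodic f"
  shows "torus_mean (partial_deriv i f) = 0"
  using partial_deriv_iter_avg_eq_0[OF assms, of i coords 0] partial_deriv_iter_avg[OF assms(1)]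
  by (simp add: torus_mean_def coords)

text \<open>This serves as integration by parts: the weighted identities below are obtained by
  expanding suitable divergences.\<close>

lemma torus_mean_divergence:
  assumes "\<And>i. Ck 1 (F i)" "\<And>i. int_periodic (F i)"
  shows "torus_mean (\<lambda>x. \<Sum>i\<in>UNIV. partial_deriv i (F i) x) = 0"
  using assms by (subst torus_mean_sum) (auto simp: torus_mean_partial_deriv[of 0])

lemma torus_mean_gradient:
  assumes "Ck (Suc m) f" "int_periodic f"
  shows "torus_mean (\<lambda>x. v \<bullet> gradient f x) = 0"
proof -
  have "torus_mean (\<lambda>x. \<Sum>i\<in>UNIV. v $ i * partial_deriv i f x) = 0"
    using assms CkD(2)[OF assms(1), THEN Ck_imp_continuous_on]
    by (subst torus_mean_sum) (auto intro!: continuous_intros simp: torus_mean_cmult torus_mean_partial_deriv)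
  then show ?thesis
    by (simp add: inner_vec_def)
qed

lemma torus_mean_laplacian:
  assumes "Ck 2 f" "int_periodic f"
  shows "torus_mean (laplacian f) = 0"
proof -
  have "Ck 1 (partial_deriv i f)" for i
    using assms(1) CkD(2) unfolding Ck_2 by blast
  then show ?thesis
    using torus_mean_divergence[of "\<lambda>i. partial_deriv i f"] assms(2)
    by (simp add: laplacian_def[abs_def] int_periodic_partial_deriv)
qed

lemma torus_mean_eq_0D:
  fixes f :: "real^'n \<Rightarrow> real"
  assumes "continuous_on UNIV f" "int_periodic f" "\<And>x. f x \<ge> 0" "torus_mean f = 0"
  shows "f x = 0"
proof -
  obtain y where y: "y \<in> cbox 0 1" "f y = f x"
    using periodic_reduce[OF assms(2)] by metis
  have "f (0 + y) = 0"
    by (rule iter_avg_eq_0D[OF assms(1,3) coords(1)])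
      (use assms(4) y in \<open>auto simp: torus_mean_def mem_box_cart coords\<close>)
  with y show ?thesis by simp
qed

text \<open>After averaging in every direction all partial derivatives vanish, so the result is
  constant and the base point 0 is immaterial.\<close>

lemma iter_avg_coords:
  assumes "Ck (Suc m) f" "int_periodic f"
  shows "iter_avg coords f x = torus_mean f"
proof -
  have "gradient (iter_avg coords f) y = 0" for y
    using partial_deriv_iter_avg_eq_0[OF assms] by (simp add: vec_eq_iff coords)
  then have "(iter_avg coords f has_derivative (\<lambda>h. 0)) (at y within UNIV)" for y
    using has_derivative_Ck[OF Ck_iter_avg[OF assms(1)], of coords y] by simp
  then obtain c where "\<And>y. iter_avg coords f y = c"
    using has_derivative_zero_constant[of UNIV "iter_avg coords f"] by auto
  then show ?thesis
    by (simp add: torus_mean_def)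
qed

text \<open>A quantitative cohomological equation \<open>\<xi> \<cdot> DW = avg f - f\<close>. The components of \<open>\<xi>\<close> decrease
  rapidly in the order in which the coordinates are averaged, so that the derivatives of the earlier
  correctors in later directions are negligible.\<close>

lemma iter_avg_corrector:
  fixes f :: "real^'n \<Rightarrow> real"
  assumes f: "Ck (Suc m) f" "int_periodic f" and "distinct L" "e > 0"
  shows "\<exists>W \<xi>. Ck (Suc m) W \<and> int_periodic W \<and> (\<forall>j. j \<notin> set L \<longrightarrow> \<xi> $ j = 0) \<and>
    (\<forall>x. \<bar>\<xi> \<bullet> gradient W x + f x - iter_avg L f x\<bar> \<le> e)"
  using assms(3,4)
proof (induction L arbitrary: e)
  case Nil
  have "gradient (\<lambda>_. 0 :: real) x = (0 :: real^'n)" for x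
    by (simp add: vec_eq_iff partial_deriv_const)
  then show ?case
    using Nil by (intro exI[of _ "\<lambda>_. 0"] exI[of _ 0]) (simp add: int_periodic_def del: Ck.simps)
next
  case (Cons i L)
  obtain W \<xi> where W: "Ck (Suc m) W" "int_periodic W" "\<And>j. j \<notin> set L \<Longrightarrow> \<xi> $ j = 0"
      "\<And>x. \<bar>\<xi> \<bullet> gradient W x + f x - iter_avg L f x\<bar> \<le> e / 2"
    using Cons.IH[of "e / 2"] Cons.prems by auto
  obtain B where B: "B > 0" "\<And>x. \<bar>partial_deriv i W x\<bar> \<le> B"
    using periodic_bounded[OF Ck_imp_continuous_on[OF CkD(2)[OF W(1)]] int_periodic_partial_deriv[OF W(2)]]
    by (metis real_norm_def)
  \<comment> \<open>The new component of the slope is so small that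
    \<open>\<delta> * partial_deriv i W\<close> is at most \<open>e / 2\<close>. The factor
    \<open>c = 1 / \<delta>\<close> on the new corrector compensates for it in direction
    \<open>i\<close>.\<close>
  define \<delta> where "\<delta> = e / (2 * B)"
  define c where "c = 1 / \<delta>"
  have \<delta>: "\<delta> > 0" "\<delta> * c = 1" "c * \<delta> = 1"
    using B Cons.prems by (simp_all add: \<delta>_def c_def)
  let ?g = "iter_avg L f"
  let ?U = "line_avg (\<lambda>s. 1 - s) i ?g"
  let ?W = "\<lambda>x. W x + c * ?U x"
  let ?\<xi> = "\<xi> + \<delta> *\<^sub>R axis i 1"
  have k: "continuous_on {0..1} (\<lambda>s. 1 - s :: real)"
    by (intro continuous_intros)
  have g: "Ck (Suc m) ?g"
    using f(1) by (rule Ck_iter_avg)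
  have U: "Ck (Suc m) ?U"
    using k g by (rule Ck_line_avg)
  have "Ck (Suc m) ?W"
    by (intro Ck_add Ck_cmult W(1) U)
  moreover have "int_periodic ?W"
    using W(2) int_periodic_line_avg[OF int_periodic_iter_avg[OF f(2)], of "\<lambda>s. 1 - s" i L]
    by (simp add: int_periodic_def)
  moreover have "?\<xi> $ j = 0" if "j \<notin> set (i # L)" for j
    using that W(3) by (auto simp: axis_def)
  moreover have "\<bar>?\<xi> \<bullet> gradient ?W x + f x - iter_avg (i # L) f x\<bar> \<le> e" for x
  proof -
    \<comment> \<open>The old slope lives on the directions in \<open>L\<close>, in which
      \<open>?g\<close>, and therefore \<open>?U\<close>, is already constant. Hence the large
      factor \<open>c\<close> causes no error.\<close>
    have "\<xi> $ j * partial_deriv j ?U x = 0" for j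
    proof (cases "j \<in> set L")
      case True
      then have "partial_deriv j ?g = (\<lambda>_. 0)"
        using partial_deriv_iter_avg_eq_0[OF f] by blast
      then show ?thesis
        unfolding partial_deriv_line_avg[OF k g] by (simp add: line_avg_def)
    qed (simp add: W(3))
    then have orth: "\<xi> \<bullet> gradient ?U x = 0"
      by (auto simp: inner_vec_def intro!: sum.neutral)
    have "?\<xi> \<bullet> gradient ?W x =
        \<xi> \<bullet> gradient W x + \<delta> * partial_deriv i W x + partial_deriv i ?U x"
      using \<delta>(2,3) orth W(1) U Ck_cmult[OF U, of c]
      by (simp add: gradient_add gradient_cmult inner_add_left inner_add_right inner_commute[of "axis i 1"]
          mult.assoc[symmetric] partial_deriv_add partial_deriv_cmult distrib_left del: Ck.simps)
    moreover have "partial_deriv i ?U x = iter_avg (i # L) f x - ?g x"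
      using line_avg_primitive[OF g] by simp
    moreover have "\<bar>\<delta> * partial_deriv i W x\<bar> \<le> \<delta> * B"
      using \<delta> B by (simp add: abs_mult)
    moreover have "\<delta> * B = e / 2"
      using B(1) by (simp add: \<delta>_def)
    ultimately show ?thesis
      using W(4)[of x] by linarith
  qed
  ultimately show ?case by blast
qed

lemma torus_corrector:
  fixes f :: "real^'n \<Rightarrow> real"
  assumes "Ck (Suc m) f" "int_periodic f" "e > 0"
  obtains W \<xi> where "Ck (Suc m) W" "int_periodic W"
    "\<And>x. \<bar>\<xi> \<bullet> gradient W x + f x - torus_mean f\<bar> \<le> e"
  using iter_avg_corrector[OF assms(1,2) coords(1) assms(3)] iter_avg_coords[OF assms(1,2)] by metis

subsection \<open>Hamiltonians with bounded second derivatives\<close>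

lemma superlinear_attains_inf:
  fixes H L :: "real^'n \<Rightarrow> real"
  assumes "continuous_on UNIV H" "superlinear H" "continuous_on UNIV L"
    and L: "\<And>p. \<bar>L p\<bar> \<le> a * norm p + b"
  obtains p where "\<And>q. H p - L p \<le> H q - L q"
proof -
  have "eventually (\<lambda>p. a + 1 \<le> H p / norm p) at_infinity"
    using assms(2) by (auto simp: superlinear_def filterlim_at_top)
  then obtain r where r: "\<And>p. r \<le> norm p \<Longrightarrow> a + 1 \<le> H p / norm p"
    by (auto simp: eventually_at_infinity)
  \<comment> \<open>Outside this radius \<open>H q - L q\<close> is at least
    \<open>norm q - b\<close>, hence at least its value at 0; a minimum over the ball is then
    global.\<close>
  define R where "R = max (max r 1) (H 0 - L 0 + b)"
  have R: "R \<ge> 0" by (simp add: R_def)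
  have outside: "H 0 - L 0 \<le> H q - L q" if "norm q > R" for q
  proof -
    have "norm q > 0" "r \<le> norm q" "H 0 - L 0 + b \<le> norm q"
      using that by (auto simp: R_def)
    then have "(a + 1) * norm q \<le> H q"
      using r[of q] by (simp add: pos_le_divide_eq)
    with L[of q] \<open>H 0 - L 0 + b \<le> norm q\<close> show ?thesis
      by (simp add: algebra_simps abs_le_iff)
  qed
  have "continuous_on (cball 0 R) (\<lambda>q. H q - L q)"
    using assms(1,3) by (intro continuous_intros) (auto intro: continuous_on_subset)
  then obtain p where p: "p \<in> cball 0 R" "\<And>q. q \<in> cball 0 R \<Longrightarrow> H p - L p \<le> H q - L q"
    using continuous_attains_inf[OF compact_cball, of 0 R "\<lambda>q. H q - L q"] R by auto
  show thesis
  proof (rule that[of p])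
    fix q
    show "H p - L p \<le> H q - L q"
      using p(2)[of q] p(2)[of 0] outside[of q] R by (cases "norm q \<le> R") auto
  qed
qed

text \<open>The point is a minimizer of \<open>H p - Q \<bullet> p\<close>, which exists by
  superlinearity; its first-order condition is the claim.\<close>

lemma superlinear_gradient_surj:
  fixes H :: "real^'n \<Rightarrow> real"
  assumes "Ck (Suc k) H" "superlinear H"
  obtains p where "gradient H p = Q"
proof -
  have "\<bar>Q \<bullet> p\<bar> \<le> norm Q * norm p + 0" for p
    using Cauchy_Schwarz_ineq2 by simp
  moreover have "continuous_on UNIV (\<lambda>p. Q \<bullet> p)"
    by (intro continuous_intros)
  ultimately obtain p where p: "\<And>q. H p - Q \<bullet> p \<le> H q - Q \<bullet> q"
    using superlinear_attains_inf[OF Ck_imp_continuous_on[OF assms(1)] assms(2)] by blast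
  have "((\<lambda>q. H q - Q \<bullet> q) has_derivative (\<lambda>h. (gradient H p - Q) \<bullet> h)) (at p)"
    using has_derivative_Ck[OF assms(1)] by (auto intro!: derivative_eq_intros simp: inner_diff_left)
  then have "(\<lambda>h. (gradient H p - Q) \<bullet> h) = (\<lambda>h. 0)"
    by (rule differential_zero_maxmin[of p UNIV, rotated 2]) (use p in auto)
  then have "gradient H p - Q = 0"
    by (meson inner_eq_zero_iff)
  then show thesis using that by simp
qed

text \<open>The supporting hyperplane is that of the strictly convex function \<open>sqrt (1 + |p|\<^sup>2)\<close>, which touches
  \<open>H\<close> from below at \<open>p\<close> up to an additive constant.\<close>

lemma superlinear_strictly_exposed:
  fixes H :: "real^'n \<Rightarrow> real"
  assumes "continuous_on UNIV H" "superlinear H"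
  obtains p Q where "\<And>y. y \<noteq> 0 \<Longrightarrow> H (p + y) > H p + Q \<bullet> y"
proof -
  define \<phi> where "\<phi> p = sqrt (1 + (norm p)\<^sup>2)" for p :: "real^'n"
  have \<phi>: "\<phi> p > 0" "(\<phi> p)\<^sup>2 = 1 + (norm p)\<^sup>2" for p
    by (simp_all add: \<phi>_def add_pos_nonneg)
  have "\<bar>\<phi> p\<bar> \<le> 1 * norm p + 1" for p
    by (auto simp: \<phi>_def power2_sum intro!: real_le_lsqrt)
  moreover have "continuous_on UNIV \<phi>"
    unfolding \<phi>_def by (intro continuous_intros)
  ultimately obtain p where p: "\<And>q. H p - \<phi> p \<le> H q - \<phi> q"
    using superlinear_attains_inf[OF assms] by blast
  show thesis
  proof (rule that)
    fix y :: "real^'n" assume "y \<noteq> 0"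
    let ?q = "p + y"
    \<comment> \<open>Cauchy-Schwarz for the vectors \<open>(1, ?q)\<close> and
      \<open>(1, p)\<close>, strict because they are not parallel when \<open>y\<close> is
      nonzero.\<close>
    have "(1 + ?q \<bullet> p)\<^sup>2 < (1 + (norm ?q)\<^sup>2) * (1 + (norm p)\<^sup>2)"
    proof -
      have "(?q \<bullet> p)\<^sup>2 \<le> (norm ?q)\<^sup>2 * (norm p)\<^sup>2"
        using Cauchy_Schwarz_ineq[of ?q p] by (simp add: power2_norm_eq_inner)
      moreover have "(norm ?q)\<^sup>2 + (norm p)\<^sup>2 - 2 * (?q \<bullet> p) = (norm y)\<^sup>2"
        by (simp add: power2_norm_eq_inner algebra_simps inner_commute)
      moreover have "(norm y)\<^sup>2 > 0"
        using \<open>y \<noteq> 0\<close> by simp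
      ultimately show ?thesis
        by (simp add: power2_eq_square algebra_simps)
    qed
    then have "(1 + ?q \<bullet> p)\<^sup>2 < (\<phi> ?q * \<phi> p)\<^sup>2"
      by (simp add: \<phi> power_mult_distrib)
    then have "1 + ?q \<bullet> p < \<phi> ?q * \<phi> p"
      by (rule power_less_imp_less_base) (simp add: \<phi>(1) less_imp_le)
    moreover have "1 + ?q \<bullet> p = (\<phi> p)\<^sup>2 + y \<bullet> p"
      by (simp add: \<phi>(2) power2_norm_eq_inner inner_add_left)
    ultimately have "\<phi> p * (\<phi> ?q - \<phi> p) > p \<bullet> y"
      by (simp add: power2_eq_square algebra_simps inner_commute)
    then have "\<phi> ?q - \<phi> p > (p \<bullet> y) / \<phi> p"
      using \<phi>(1)[of p] by (simp add: pos_divide_less_eq mult.commute)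
    \<comment> \<open>The slope is the gradient of \<open>\<phi>\<close> at \<open>p\<close>;
      minimality of \<open>H - \<phi>\<close> at \<open>p\<close> transfers the strict inequality
      from \<open>\<phi>\<close> to \<open>H\<close>.\<close>
    then show "H (p + y) > H p + ((1 / \<phi> p) *\<^sub>R p) \<bullet> y"
      using p[of ?q] by simp
  qed
qed

text \<open>Second-order Taylor estimate along the segment from \<open>p\<close> to
  \<open>p + y\<close>, by two applications of the mean value theorem. \<open>K\<close> bounds the
  Hessian itself, without the sharp factor 1/2.\<close>

lemma quadratic_upper_bound:
  fixes H :: "real^'n \<Rightarrow> real"
  assumes H: "Ck 2 H" and "bdd_above (range (\<lambda>p. onorm ((*v) (hessian H p))))"
  obtains K where "K \<ge> 0" "\<And>p y. H (p + y) \<le> H p + gradient H p \<bullet> y + K * (norm y)\<^sup>2"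
proof -
  obtain K where K: "\<And>p. onorm ((*v) (hessian H p)) \<le> K"
    using assms(2) by (auto simp: bdd_above_def)
  have H1: "Ck (Suc 1) H" and H2: "Ck (Suc 0) (partial_deriv j H)" for j
    using H by (simp_all add: Ck_2)
  have "K \<ge> 0"
    using K[of 0] onorm_pos_le[OF matrix_vector_mul_bounded_linear, of "hessian H 0"] by linarith
  moreover have "H (p + y) \<le> H p + gradient H p \<bullet> y + K * (norm y)\<^sup>2" for p y
  proof -
    let ?g = "\<lambda>r. gradient H (p + r *\<^sub>R y) \<bullet> y"
    let ?h = "\<lambda>r. y \<bullet> (hessian H (p + r *\<^sub>R y) *v y)"
    have "((\<lambda>r. \<Sum>j\<in>UNIV. partial_deriv j H (p + r *\<^sub>R y) * y $ j) has_real_derivative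
        (\<Sum>j\<in>UNIV. (gradient (partial_deriv j H) (p + r *\<^sub>R y) \<bullet> y) * y $ j)) (at r)" for r
      by (intro DERIV_sum DERIV_cmult_right has_real_derivative_along[OF H2])
    moreover have "(\<Sum>j\<in>UNIV. (gradient (partial_deriv j H) x \<bullet> y) * y $ j) = y \<bullet> (hessian H x *v y)" for x
    proof -
      have "(\<Sum>j\<in>UNIV. (gradient (partial_deriv j H) x \<bullet> y) * y $ j) =
          (\<Sum>j\<in>UNIV. \<Sum>i\<in>UNIV. y $ i * (partial_deriv i (partial_deriv j H) x * y $ j))"
        by (simp add: inner_vec_def sum_distrib_left sum_distrib_right ac_simps)
      also have "\<dots> = (\<Sum>i\<in>UNIV. \<Sum>j\<in>UNIV. y $ i * (partial_deriv i (partial_deriv j H) x * y $ j))"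
        by (rule sum.swap)
      also have "\<dots> = y \<bullet> (hessian H x *v y)"
        by (simp add: inner_vec_def matrix_vector_mult_def hessian_def sum_distrib_left)
      finally show ?thesis .
    qed
    ultimately have dg: "(?g has_real_derivative ?h r) (at r)" for r
      by (simp add: inner_vec_def[of "gradient H _"])
    have bound: "?h r \<le> K * (norm y)\<^sup>2" for r
    proof -
      have "?h r \<le> norm y * norm (hessian H (p + r *\<^sub>R y) *v y)"
        by (rule norm_cauchy_schwarz)
      also have "norm (hessian H (p + r *\<^sub>R y) *v y) \<le> onorm ((*v) (hessian H (p + r *\<^sub>R y))) * norm y"
        by (rule onorm[OF matrix_vector_mul_bounded_linear])
      also have "\<dots> \<le> K * norm y"
        by (intro mult_right_mono K) simp
      finally show ?thesis
        by (simp add: power2_eq_square mult_left_mono mult.left_commute)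
    qed
    obtain s where s: "0 < s" "s < 1" "H (p + 1 *\<^sub>R y) - H (p + 0 *\<^sub>R y) = (1 - 0) * ?g s"
      using MVT2[of 0 1 "\<lambda>r. H (p + r *\<^sub>R y)" ?g] has_real_derivative_along[OF H1] by auto
    obtain r where r: "?g s - ?g 0 = (s - 0) * ?h r"
      using MVT2[of 0 s ?g ?h] dg s(1) by auto
    have "s * ?h r \<le> s * (K * (norm y)\<^sup>2)"
      using bound s by (intro mult_left_mono) auto
    also have "\<dots> \<le> 1 * (K * (norm y)\<^sup>2)"
      using s \<open>K \<ge> 0\<close> by (intro mult_right_mono) auto
    finally show ?thesis
      using s r by simp
  qed
  ultimately show thesis
    using that by blast
qed

text \<open>The test function is \<open>c * W\<close> at a point \<open>p\<close> with slope
  \<open>\<xi> / c\<close>. The linear term of \<open>H\<close> is then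
  \<open>\<xi> \<bullet> gradient W\<close> for every \<open>c\<close>, while the diffusion and the
  quadratic remainder are of order \<open>c\<close>.\<close>

lemma cell_solution_mean_ge:
  fixes H :: "real^'n \<Rightarrow> real"
  assumes "d > 0" and V: "Ck 2 V" "int_periodic V"
    and H: "Ck 2 H" "bdd_above (range (\<lambda>p. onorm ((*v) (hessian H p))))" "superlinear H"
    and sol: "\<And>p. \<exists>w. cell_solution d H V p (H p) w"
  shows "torus_mean V \<ge> 0"
proof (rule field_le_epsilon)
  fix e :: real assume "e > 0"
  obtain K where K: "K \<ge> 0" "\<And>p y. H (p + y) \<le> H p + gradient H p \<bullet> y + K * (norm y)\<^sup>2"
    using quadratic_upper_bound[OF H(1,2)] by blast
  obtain W \<xi> where W: "Ck 2 W" "int_periodic W"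
      "\<And>x. \<bar>\<xi> \<bullet> gradient W x + V x - torus_mean V\<bar> \<le> e / 2"
    using torus_corrector[of 1 V "e / 2"] V \<open>e > 0\<close> unfolding Ck_2 by auto
  obtain B1 where B1: "B1 > 0" "\<And>x. norm (laplacian W x) \<le> B1"
    using periodic_bounded[OF continuous_on_laplacian[OF W(1)] int_periodic_laplacian[OF W(2)]] by blast
  obtain B2 where B2: "B2 > 0" "\<And>x. norm (gradient W x) \<le> B2"
    using periodic_bounded[OF continuous_on_gradient int_periodic_gradient[OF W(2)]] W(1)
    unfolding Ck_2 by blast
  \<comment> \<open>\<open>c * A\<close> bounds the diffusion error plus the Taylor error;
    \<open>c \<le> 1\<close> is what lets the quadratic error, of order \<open>c\<^sup>2\<close>, be
    absorbed.\<close>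
  define A where "A = d * B1 + K * B2\<^sup>2"
  have A: "A > 0"
    using \<open>d > 0\<close> B1 K(1) by (simp add: A_def add_pos_nonneg)
  define c where "c = min 1 (e / (2 * A))"
  have c: "c > 0" "c \<le> 1" "c * A \<le> e / 2"
    using \<open>e > 0\<close> A by (auto simp: c_def min_def field_simps)
  obtain p where p: "gradient H p = (1 / c) *\<^sub>R \<xi>"
    using superlinear_gradient_surj[of 1 H] H by (metis Ck_2)
  obtain w where w: "Ck 2 w" "int_periodic w"
      "\<And>x. - d * laplacian w x + H (p + gradient w x) + V x = H p"
    using sol[of p] by (auto simp: cell_solution_def)
  have "int_periodic (\<lambda>x. c * W x)"
    using W(2) by (simp add: int_periodic_def)
  then obtain x where x: "gradient (\<lambda>x. c * W x) x = gradient w x"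
      "laplacian (\<lambda>x. c * W x) x \<le> laplacian w x"
    using periodic_comparison[OF Ck_cmult[OF W(1)] _ w(1,2)] by blast
  have grad: "gradient w x = c *\<^sub>R gradient W x"
    using x(1) gradient_cmult[of 1 W c x] W(1) by (simp add: Ck_2 del: Ck.simps)
  \<comment> \<open>The equation of \<open>w\<close> is estimated at the contact point;
    \<open>H p\<close> occurs on both sides and cancels.\<close>
  have "H p = - d * laplacian w x + H (p + c *\<^sub>R gradient W x) + V x"
    using w(3)[of x] grad by simp
  also have "H (p + c *\<^sub>R gradient W x) \<le>
      H p + gradient H p \<bullet> (c *\<^sub>R gradient W x) + K * (norm (c *\<^sub>R gradient W x))\<^sup>2"
    by (rule K(2))
  also have "gradient H p \<bullet> (c *\<^sub>R gradient W x) = \<xi> \<bullet> gradient W x"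
    using c(1) by (simp add: p)
  also have "K * (norm (c *\<^sub>R gradient W x))\<^sup>2 \<le> c * (K * B2\<^sup>2)"
  proof -
    have "(norm (c *\<^sub>R gradient W x))\<^sup>2 = c * (c * (norm (gradient W x))\<^sup>2)"
      by (simp add: power_mult_distrib power2_eq_square)
    also have "c * (norm (gradient W x))\<^sup>2 \<le> 1 * B2\<^sup>2"
      using c B2 by (intro mult_mono power_mono) auto
    finally have "(norm (c *\<^sub>R gradient W x))\<^sup>2 \<le> c * B2\<^sup>2"
      using c(1) by simp
    from mult_left_mono[OF this K(1)] show ?thesis
      by (simp add: mult.left_commute)
  qed
  also have "- d * laplacian w x \<le> c * (d * B1)"
  proof -
    have "c * laplacian W x \<le> laplacian w x"
      using x(2) laplacian_cmult[OF W(1)] by simp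
    moreover have "c * laplacian W x \<ge> c * (- B1)"
      using B1(2)[of x] c(1) by (intro mult_left_mono) auto
    ultimately have "- laplacian w x \<le> c * B1" by simp
    from mult_left_mono[OF this, of d] \<open>d > 0\<close> show ?thesis
      by (simp add: mult.left_commute)
  qed
  finally have "0 \<le> c * A + (\<xi> \<bullet> gradient W x + V x)"
    by (simp add: A_def distrib_left)
  with c(3) W(3)[of x] show "0 \<le> torus_mean V + e"
    by linarith
qed

lemma potential_eq_0_of_bounded_hessian:
  fixes H :: "real^'n \<Rightarrow> real"
  assumes "d > 0" and V: "Ck 2 V" "int_periodic V"
    and H: "Ck 2 H" "bdd_above (range (\<lambda>p. onorm ((*v) (hessian H p))))" "superlinear H"
    and sol: "\<And>p. \<exists>w. cell_solution d H V p (H p) w"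
  shows "V x = 0"
proof -
  have contH: "continuous_on UNIV H" and contV: "continuous_on UNIV V"
    using Ck_imp_continuous_on[OF H(1)] Ck_imp_continuous_on[OF V(1)] .
  obtain p Q where pQ: "\<And>y. y \<noteq> 0 \<Longrightarrow> H (p + y) > H p + Q \<bullet> y"
    using superlinear_strictly_exposed[OF contH H(3)] by blast
  obtain w where w: "Ck 2 w" "int_periodic w"
      "\<And>x. - d * laplacian w x + H (p + gradient w x) + V x = H p"
    using sol[of p] by (auto simp: cell_solution_def)
  have w1: "Ck (Suc 1) w"
    using w(1) by (simp add: Ck_2)
  let ?R = "\<lambda>x. d * laplacian w x - Q \<bullet> gradient w x - V x"
  \<comment> \<open>The two forms of \<open>?R\<close> play different roles: the left one has mean
    \<open>- torus_mean V\<close>, the right one is the excess of \<open>H\<close> over its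
    supporting hyperplane and so is nonnegative.\<close>
  have R: "?R x = H (p + gradient w x) - H p - Q \<bullet> gradient w x" for x
    using w(3)[of x] by simp
  have R_nonneg: "?R x \<ge> 0" for x
    using pQ[of "gradient w x"] unfolding R by (cases "gradient w x = 0") auto
  note cont = continuous_on_laplacian[OF w(1)] continuous_on_gradient[OF w1] contV
  have contR: "continuous_on UNIV ?R"
    by (intro continuous_intros cont)
  have "torus_mean ?R = d * torus_mean (laplacian w) - torus_mean (\<lambda>x. Q \<bullet> gradient w x) - torus_mean V"
    by (simp add: torus_mean_diff torus_mean_cmult continuous_intros cont)
  also have "\<dots> = - torus_mean V"
    using torus_mean_laplacian[OF w(1,2)] torus_mean_gradient[OF w1 w(2)] by simp
  also have "\<dots> \<le> 0"
    using cell_solution_mean_ge[OF assms] by simp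
  finally have "torus_mean ?R \<le> 0" .
  moreover have "torus_mean ?R \<ge> 0"
    using torus_mean_mono[of "\<lambda>_. 0", OF _ contR] R_nonneg by simp
  ultimately have "torus_mean ?R = 0"
    by (rule antisym)
  moreover have "int_periodic ?R"
    using int_periodic_laplacian[OF w(2)] int_periodic_gradient[OF w(2)] V(2)
    by (simp add: int_periodic_def)
  ultimately have R0: "?R x = 0" for x
    using torus_mean_eq_0D[OF contR _ R_nonneg] by blast
  have "gradient w x = 0" for x
  proof (rule ccontr)
    assume "gradient w x \<noteq> 0"
    then have "H (p + gradient w x) > H p + Q \<bullet> gradient w x"
      by (rule pQ)
    with R0[of x] R[of x] show False by linarith
  qed
  then show ?thesis
    using w(3)[of x] laplacian_eq_0_of_gradient[of w x] by simp
qed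

subsection \<open>The quadratic Hamiltonian\<close>

text \<open>The integrand is the derivative of \<open>exp (a * v) * g\<close> in direction
  \<open>\<xi>\<close>.\<close>

lemma torus_mean_exp_gradient:
  assumes v: "Ck (Suc k) v" "int_periodic v" and g: "Ck (Suc k) g" "int_periodic g"
  shows "torus_mean (\<lambda>x. exp (a * v x) * (\<xi> \<bullet> gradient g x + a * g x * (\<xi> \<bullet> gradient v x))) = 0"
proof -
  have av: "Ck (Suc k) (\<lambda>x. a * v x)"
    using v(1) by (rule Ck_cmult)
  note s = Ck_exp[OF av]
  have "int_periodic (\<lambda>x. exp (a * v x) * g x)"
    using v(2) g(2) by (simp add: int_periodic_def)
  then have "torus_mean (\<lambda>x. \<xi> \<bullet> gradient (\<lambda>x. exp (a * v x) * g x) x) = 0"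
    using Ck_mult[OF s g(1)] by (intro torus_mean_gradient)
  moreover have "gradient (\<lambda>x. exp (a * v x) * g x) x =
      exp (a * v x) *\<^sub>R (gradient g x + (a * g x) *\<^sub>R gradient v x)" for x
    unfolding vec_eq_iff
    by (simp only: gradient_nth partial_deriv_mult[OF s g(1)] partial_deriv_exp[OF av] partial_deriv_cmult[OF v(1)])
      (simp add: algebra_simps)
  ultimately show ?thesis
    by (simp add: inner_add_right)
qed

text \<open>The integrand is the divergence of \<open>exp (a * v) * g * gradient v\<close>.\<close>

lemma torus_mean_exp_laplacian:
  assumes v: "Ck 2 v" "int_periodic v" and g: "Ck 1 g" "int_periodic g"
  shows "torus_mean (\<lambda>x. exp (a * v x) *
    (g x * laplacian v x + gradient g x \<bullet> gradient v x + a * g x * (norm (gradient v x))\<^sup>2)) = 0"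
proof -
  have v1: "Ck (Suc 1) v"
    using v(1) by (simp add: Ck_2)
  have av: "Ck (Suc 0) (\<lambda>x. a * v x)"
    using Ck_lower[OF v1] by (simp add: Ck_cmult del: Ck.simps)
  note s = Ck_exp[OF av]
  have g1: "Ck (Suc 0) g"
    using g(1) by simp
  have dv: "Ck (Suc 0) (partial_deriv i v)" for i
    using CkD(2)[OF v1] by simp
  note gdv = Ck_mult[OF g1 dv]
  let ?F = "\<lambda>i x. exp (a * v x) * (g x * partial_deriv i v x)"
  have "Ck 1 (?F i)" for i
    using Ck_mult[OF s gdv] by simp
  moreover have "int_periodic (?F i)" for i
    using v(2) g(2) int_periodic_partial_deriv[OF v(2)] by (simp add: int_periodic_def)
  ultimately have "torus_mean (\<lambda>x. \<Sum>i\<in>UNIV. partial_deriv i (?F i) x) = 0"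
    by (rule torus_mean_divergence)
  moreover have "(\<Sum>i\<in>UNIV. partial_deriv i (?F i) x) = exp (a * v x) *
    (g x * laplacian v x + gradient g x \<bullet> gradient v x + a * g x * (norm (gradient v x))\<^sup>2)" for x
  proof -
    have "partial_deriv i (?F i) x = exp (a * v x) *
        (g x * partial_deriv i (partial_deriv i v) x + partial_deriv i g x * partial_deriv i v x
          + a * g x * (partial_deriv i v x * partial_deriv i v x))" for i
      by (simp only: partial_deriv_mult[OF s gdv] partial_deriv_mult[OF g1 dv] partial_deriv_exp[OF av]
          partial_deriv_cmult[OF v1]) (simp add: algebra_simps)
    then show ?thesis
      by (simp add: laplacian_def inner_vec_def power2_norm_eq_inner sum_distrib_left sum.distrib distrib_left
          mult.assoc)
  qed
  ultimately show ?thesis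
    by simp
qed

text \<open>Subtracting the two cell equations cancels \<open>V\<close> and the square of
  \<open>gradient w0\<close>.\<close>

lemma cell_solution_difference:
  assumes "cell_solution d (\<lambda>p. (norm p)\<^sup>2) V 0 0 w0" "cell_solution d (\<lambda>p. (norm p)\<^sup>2) V p c w"
  defines "v \<equiv> \<lambda>x. w x - w0 x"
  shows "- d * laplacian v x + (norm (p + gradient v x))\<^sup>2 + 2 * (gradient w0 x \<bullet> (p + gradient v x)) = c"
proof -
  have w0: "Ck 2 w0" "- d * laplacian w0 x + (norm (gradient w0 x))\<^sup>2 + V x = 0"
    and w: "Ck 2 w" "- d * laplacian w x + (norm (p + gradient w x))\<^sup>2 + V x = c"
    using assms(1,2) by (auto simp: cell_solution_def)
  have l: "laplacian v x = laplacian w x - laplacian w0 x"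
    unfolding v_def by (rule laplacian_diff[OF w(1) w0(1)])
  have "gradient v x = gradient w x - gradient w0 x"
    unfolding v_def by (rule gradient_diff[of 1]) (use w(1) w0(1) in \<open>simp_all only: Ck_2\<close>)
  then have "p + gradient w x = (p + gradient v x) + gradient w0 x"
    by simp
  then have "(norm (p + gradient w x))\<^sup>2 =
      (norm (p + gradient v x))\<^sup>2 + 2 * (gradient w0 x \<bullet> (p + gradient v x)) + (norm (gradient w0 x))\<^sup>2"
    by (simp only: power2_norm_eq_inner) (simp add: algebra_simps inner_commute)
  with w(2) w0(2) show ?thesis
    unfolding l by (simp add: algebra_simps)
qed

text \<open>The weight \<open>exp (- 2 v / d)\<close> is the square of the Hopf--Cole transform of \<open>v\<close>.\<close>

lemma weighted_cell_identity:
  assumes "d > 0"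
    and w0: "cell_solution d (\<lambda>p. (norm p)\<^sup>2) V 0 0 w0"
    and w: "cell_solution d (\<lambda>p. (norm p)\<^sup>2) V p c w"
    and g: "Ck 1 g" "int_periodic g"
  defines "v \<equiv> \<lambda>x. w x - w0 x"
  shows "torus_mean (\<lambda>x. exp (- (2 / d) * v x) * (g x * (c - (norm p)\<^sup>2 + (norm (gradient v x))\<^sup>2
      - 2 * (p \<bullet> gradient v x) - 2 * (p \<bullet> gradient w0 x) - 2 * (gradient w0 x \<bullet> gradient v x))
      - d * (gradient g x \<bullet> gradient v x))) = 0"
proof -
  have v: "Ck 2 v" "int_periodic v"
    using w0 w by (auto simp: v_def cell_solution_def int_periodic_def intro: Ck_diff simp del: Ck.simps)
  let ?s = "\<lambda>x. exp (- (2 / d) * v x)"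
  let ?f = "\<lambda>x. ?s x * (g x * laplacian v x + gradient g x \<bullet> gradient v x
      + - (2 / d) * g x * (norm (gradient v x))\<^sup>2)"
  have "?s x * (g x * (c - (norm p)\<^sup>2 + (norm (gradient v x))\<^sup>2
      - 2 * (p \<bullet> gradient v x) - 2 * (p \<bullet> gradient w0 x) - 2 * (gradient w0 x \<bullet> gradient v x))
      - d * (gradient g x \<bullet> gradient v x)) = - d * ?f x" for x
  proof -
    have c: "c = - d * laplacian v x + (norm (p + gradient v x))\<^sup>2 + 2 * (gradient w0 x \<bullet> (p + gradient v x))"
      using cell_solution_difference[OF w0 w] by (simp add: v_def)
    have "(norm (p + gradient v x))\<^sup>2 = (norm p)\<^sup>2 + 2 * (p \<bullet> gradient v x) + (norm (gradient v x))\<^sup>2"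
      by (simp only: power2_norm_eq_inner) (simp add: algebra_simps inner_commute)
    \<comment> \<open>This bracket is written so that only the Laplacian and twice the squared
      gradient remain, matching the divergence identity for \<open>a = - (2 / d)\<close> multiplied
      by \<open>- d\<close>.\<close>
    then have eq: "c - (norm p)\<^sup>2 + (norm (gradient v x))\<^sup>2
      - 2 * (p \<bullet> gradient v x) - 2 * (p \<bullet> gradient w0 x) - 2 * (gradient w0 x \<bullet> gradient v x)
      = - d * laplacian v x + 2 * (norm (gradient v x))\<^sup>2"
      unfolding c by (simp add: inner_add_right inner_commute)
    show ?thesis
      unfolding eq using \<open>d > 0\<close> by (simp add: field_simps)
  qed
  then show ?thesis
    using torus_mean_exp_laplacian[OF v g, of "- (2 / d)"] torus_mean_cmult[of "- d" ?f]
    by simp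
qed

text \<open>\<open>exp (- 2 w\<^sub>0 / d)\<close> is the invariant density of the linearization at \<open>w\<^sub>0\<close>; taking it as test function
  cancels all terms of first order in \<open>v\<close>.\<close>

lemma weighted_energy_identity:
  assumes "d > 0"
    and w0: "cell_solution d (\<lambda>p. (norm p)\<^sup>2) V 0 0 w0"
    and w: "cell_solution d (\<lambda>p. (norm p)\<^sup>2) V p c w"
  defines "v \<equiv> \<lambda>x. w x - w0 x"
  shows "torus_mean (\<lambda>x. exp (- (2 / d) * v x) *
    (exp (- (2 / d) * w0 x) * (c - (norm p)\<^sup>2 + (norm (gradient v x))\<^sup>2))) = 0"
proof -
  have w0': "Ck (Suc 1) w0" "int_periodic w0" and v: "Ck (Suc 1) v" "int_periodic v"
    using w0 w unfolding v_def cell_solution_def Ck_2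
    by (auto simp: int_periodic_def intro: Ck_diff simp del: Ck.simps)
  let ?a = "- (2 / d)"
  let ?s = "\<lambda>x. exp (?a * v x)" and ?m = "\<lambda>x. exp (?a * w0 x)"
  have m: "Ck (Suc 1) ?m"
    by (intro Ck_exp Ck_cmult w0')
  have m_per: "int_periodic ?m"
    using w0'(2) by (simp add: int_periodic_def)
  have dm: "gradient ?m x = (?a * ?m x) *\<^sub>R gradient w0 x" for x
    unfolding vec_eq_iff
    by (simp add: partial_deriv_exp[OF Ck_cmult[OF w0'(1), of ?a], simplified]
        partial_deriv_cmult[OF w0'(1), of _ "?a", simplified])
  let ?f = "\<lambda>x. ?s x * (?m x * (c - (norm p)\<^sup>2 + (norm (gradient v x))\<^sup>2
      - 2 * (p \<bullet> gradient v x) - 2 * (p \<bullet> gradient w0 x) - 2 * (gradient w0 x \<bullet> gradient v x))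
      - d * (gradient ?m x \<bullet> gradient v x))"
  let ?g = "\<lambda>x. ?s x * (p \<bullet> gradient ?m x + ?a * ?m x * (p \<bullet> gradient v x))"
  have f: "torus_mean ?f = 0"
    unfolding v_def by (rule weighted_cell_identity[OF \<open>d > 0\<close> w0 w _ m_per]) (rule Ck_lower[OF m])
  have g: "torus_mean ?g = 0"
    by (rule torus_mean_exp_gradient[OF v m m_per])
  \<comment> \<open>Since the gradient of \<open>?m\<close> is \<open>- (2 / d) * ?m\<close> times
    that of \<open>w0\<close>, the terms in \<open>gradient w0 x \<bullet> gradient v x\<close>
    cancel within \<open>?f\<close>. Subtracting \<open>d * ?g\<close> removes the two terms linear
    in \<open>p\<close>.\<close>
  have "?f x - d * ?g x = ?s x * (?m x * (c - (norm p)\<^sup>2 + (norm (gradient v x))\<^sup>2))" for x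
    using \<open>d > 0\<close> unfolding dm by (simp add: field_simps)
  moreover have "torus_mean (\<lambda>x. ?f x - d * ?g x) = torus_mean ?f - d * torus_mean ?g"
  proof -
    note cont = continuous_on_gradient[OF v(1)] continuous_on_gradient[OF m] continuous_on_gradient[OF w0'(1)]
      Ck_imp_continuous_on[OF v(1)] Ck_imp_continuous_on[OF w0'(1)]
    have "continuous_on UNIV ?f" "continuous_on UNIV (\<lambda>x. d * ?g x)"
      by (intro continuous_intros cont)+
    then show ?thesis
      using torus_mean_diff[of ?f "\<lambda>x. d * ?g x"] torus_mean_cmult[of d ?g] by simp
  qed
  ultimately show ?thesis
    using f g by simp
qed

text \<open>If the effective Hamiltonian is \<open>|p|\<^sup>2 + o(|p|\<^sup>2)\<close> along the \<open>i\<close>-axis, then in the normalized weight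
  \<open>exp (- 2 v / d)\<close> the gradient of \<open>v\<close> is of smaller order than \<open>|p|\<close>. This makes the weighted mean
  of \<open>(\<partial>\<^sub>i w\<^sub>0)\<^sup>2\<close> small and, by the corrector, close to its unweighted mean.\<close>

lemma cell_solution_partial_deriv_eq_0:
  fixes w0 :: "real^'n \<Rightarrow> real"
  assumes "d > 0"
    and w0: "cell_solution d (\<lambda>p. (norm p)\<^sup>2) V 0 0 w0"
    and small: "\<And>\<delta>. 0 < \<delta> \<Longrightarrow> \<delta> \<le> 1 \<Longrightarrow> \<exists>t c w. 0 < t \<and> t \<le> 1 \<and>
      cell_solution d (\<lambda>p. (norm p)\<^sup>2) V (t *\<^sub>R axis i 1) c w \<and> \<bar>c - t\<^sup>2\<bar> \<le> \<delta>\<^sup>2 * t\<^sup>2"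
  shows "partial_deriv i w0 x = 0"
proof (rule ccontr)
  assume nz: "partial_deriv i w0 x \<noteq> 0"
  have w0': "Ck (Suc 1) w0" "int_periodic w0"
    using w0 by (auto simp: cell_solution_def Ck_2 simp del: Ck.simps)
  define h where "h = partial_deriv i w0"
  have h: "Ck 1 h" "int_periodic h"
    unfolding h_def using CkD(2)[OF w0'(1)] int_periodic_partial_deriv[OF w0'(2)] by blast+
  have h1: "Ck (Suc 0) h"
    using h(1) by simp
  define f where "f x = h x * h x" for x
  have f: "Ck (Suc 0) f" "int_periodic f" "\<And>x. f x \<ge> 0"
    using Ck_mult[OF h1 h1] h(2) by (simp_all add: f_def[abs_def] int_periodic_def)
  define \<kappa> where "\<kappa> = torus_mean f"
  have "\<kappa> \<ge> 0"
    using torus_mean_mono[of "\<lambda>_. 0" f] f Ck_imp_continuous_on[OF f(1)] by (simp add: \<kappa>_def)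
  moreover have "f x \<noteq> 0"
    using nz by (simp add: f_def h_def)
  then have "\<kappa> \<noteq> 0"
    using torus_mean_eq_0D[OF Ck_imp_continuous_on[OF f(1)] f(2,3), of x] unfolding \<kappa>_def by blast
  ultimately have "\<kappa> > 0" by simp
  \<comment> \<open>With this tolerance \<open>\<xi> \<bullet> gradient W x + f x\<close> is at
    least \<open>\<kappa> / 2\<close> everywhere.\<close>
  obtain W \<xi> where W: "Ck (Suc 0) W" "int_periodic W"
      "\<And>x. \<bar>\<xi> \<bullet> gradient W x + f x - \<kappa>\<bar> \<le> \<kappa> / 2"
    using torus_corrector[OF f(1,2), of "\<kappa> / 2"] \<open>\<kappa> > 0\<close> unfolding \<kappa>_def[symmetric] by auto
  obtain B0 where B0: "B0 > 0" "\<And>x. norm (w0 x) \<le> B0"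
    using periodic_bounded[OF Ck_imp_continuous_on[OF w0'(1)] w0'(2)] by blast
  obtain B where B: "B > 0" "\<And>x. norm (gradient w0 x) \<le> B"
    using periodic_bounded[OF continuous_on_gradient[OF w0'(1)] int_periodic_gradient[OF w0'(2)]] by blast
  obtain Bh where Bh: "Bh > 0" "\<And>x. norm (gradient h x) \<le> Bh"
    using periodic_bounded[OF continuous_on_gradient[OF h1] int_periodic_gradient[OF h(2)]] by blast
  obtain BW where BW: "BW > 0" "\<And>x. norm (W x) \<le> BW"
    using periodic_bounded[OF Ck_imp_continuous_on[OF W(1)] W(2)] by blast
  have hB: "\<bar>h x\<bar> \<le> B" for x
    using component_le_norm_cart[of "gradient w0 x" i] B(2)[of x] by (simp add: h_def)

  let ?m = "\<lambda>x. exp (- (2 / d) * w0 x)"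
  define m0 where "m0 = exp (- (2 / d) * B0)"
  define m1 where "m1 = exp ((2 / d) * B0)"
  have m: "m0 \<le> ?m x" "?m x \<le> m1" for x
  proof -
    have "(2 / d) * w0 x \<le> (2 / d) * B0" "(2 / d) * - w0 x \<le> (2 / d) * B0"
      using B0(2)[of x] \<open>d > 0\<close> by (intro mult_left_mono; simp add: abs_le_iff)+
    then show "m0 \<le> ?m x" "?m x \<le> m1"
      by (simp_all add: m0_def m1_def)
  qed
  have m_pos: "m0 > 0" "m1 > 0"
    by (simp_all add: m0_def m1_def)
  define C where "C = m1 / m0"
  have C: "C > 0"
    using m_pos by (simp add: C_def)
  define B' where "B' = 2 * B + 2 * B\<^sup>2 + d * Bh"
  define D where "D = (2 / d) * (BW * norm \<xi>)"
  \<comment> \<open>The total coefficient of \<open>\<delta>\<close> in the final estimate. It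
    depends only on \<open>w0\<close>, \<open>d\<close>, \<open>i\<close> and the corrector, so
    \<open>\<delta>\<close> can be fixed before \<open>t\<close>, \<open>c\<close> and
    \<open>w\<close>.\<close>
  define A where "A = (B + B * C + B' * ((1 + C) / 2)) / 2 + D * ((1 + C) / 2)"
  have B': "B' \<ge> 0" and D: "D \<ge> 0"
    using B Bh BW \<open>d > 0\<close> by (simp_all add: B'_def D_def)
  have "A > 0"
    using B C B' D by (simp add: A_def add_pos_nonneg)
  define \<delta> where "\<delta> = min 1 (\<kappa> / (4 * A))"
  have \<delta>: "0 < \<delta>" "\<delta> \<le> 1" "\<delta> * A < \<kappa> / 2"
    using \<open>\<kappa> > 0\<close> \<open>A > 0\<close> by (auto simp: \<delta>_def min_def field_simps)

  obtain t c w where t: "0 < t" "t \<le> 1" and c: "\<bar>c - t\<^sup>2\<bar> \<le> \<delta>\<^sup>2 * t\<^sup>2"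
    and w: "cell_solution d (\<lambda>p. (norm p)\<^sup>2) V (t *\<^sub>R axis i 1) c w"
    using small[OF \<delta>(1,2)] by blast
  define v where "v = (\<lambda>x. w x - w0 x)"
  have v: "Ck (Suc 1) v" "int_periodic v"
    using w0 w unfolding v_def cell_solution_def Ck_2
    by (auto simp: int_periodic_def intro: Ck_diff simp del: Ck.simps)
  define p where "p = t *\<^sub>R axis i (1::real)"
  have p: "norm p = t" "p \<bullet> gradient w0 x = t * h x" "norm p \<le> 1" for x
    using t by (simp_all add: p_def h_def inner_commute[of "axis i 1"])
  let ?s = "\<lambda>x. exp (- (2 / d) * v x)"
  let ?q = "\<lambda>x. norm (gradient v x)"
  note cont = continuous_on_gradient[OF v(1)] continuous_on_gradient[OF w0'(1)] continuous_on_gradient[OF h1]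
    continuous_on_gradient[OF W(1)]
    Ck_imp_continuous_on[OF v(1)] Ck_imp_continuous_on[OF w0'(1)] Ck_imp_continuous_on[OF h1]
    Ck_imp_continuous_on[OF W(1)] Ck_imp_continuous_on[OF f(1)]
  \<comment> \<open>\<open>E\<close> is the mean in the unnormalized weight \<open>?s\<close>. Its
    total mass \<open>S\<close> depends on \<open>t\<close>, so all bounds below are proportional to
    \<open>S\<close>.\<close>
  define E where "E a = torus_mean (\<lambda>x. ?s x * a x)" for a :: "real^'n \<Rightarrow> real"
  have E_mono: "E a \<le> E b" if "continuous_on UNIV a" "continuous_on UNIV b" "\<And>x. a x \<le> b x" for a b
    unfolding E_def using that by (intro torus_mean_mono continuous_intros cont) auto
  define S where "S = E (\<lambda>_. 1)"
  define \<eta> where "\<eta> = E (\<lambda>x. (?q x)\<^sup>2)"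
  define N where "N = E ?q"
  \<comment> \<open>Every pointwise bound below is put into this shape, padded with zero
    coefficients, so that its weighted mean can be read off.\<close>
  have E_comb: "E (\<lambda>x. a0 + a1 * (?q x)\<^sup>2 + a2 * ?q x + a3 * f x) = a0 * S + a1 * \<eta> + a2 * N + a3 * E f"
    for a0 a1 a2 a3
  proof -
    have "E (\<lambda>x. a0 + a1 * (?q x)\<^sup>2 + a2 * ?q x + a3 * f x) =
        torus_mean (\<lambda>x. a0 * (?s x * 1) + a1 * (?s x * (?q x)\<^sup>2) + a2 * (?s x * ?q x) + a3 * (?s x * f x))"
      unfolding E_def by (rule arg_cong[of _ _ torus_mean]) (simp add: fun_eq_iff algebra_simps)
    also have "\<dots> = torus_mean (\<lambda>x. a0 * (?s x * 1)) + torus_mean (\<lambda>x. a1 * (?s x * (?q x)\<^sup>2))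
        + torus_mean (\<lambda>x. a2 * (?s x * ?q x)) + torus_mean (\<lambda>x. a3 * (?s x * f x))"
    proof -
      have 1: "continuous_on UNIV (\<lambda>x. a0 * (?s x * 1))" and 2: "continuous_on UNIV (\<lambda>x. a1 * (?s x * (?q x)\<^sup>2))"
        and 3: "continuous_on UNIV (\<lambda>x. a2 * (?s x * ?q x))" and 4: "continuous_on UNIV (\<lambda>x. a3 * (?s x * f x))"
        by (intro continuous_intros cont)+
      show ?thesis
        unfolding torus_mean_add[OF continuous_on_add[OF continuous_on_add[OF 1 2] 3] 4]
          torus_mean_add[OF continuous_on_add[OF 1 2] 3] torus_mean_add[OF 1 2] ..
    qed
    finally show ?thesis
      by (simp only: torus_mean_cmult S_def \<eta>_def N_def E_def)
  qed
  have cont_comb: "continuous_on UNIV (\<lambda>x. a0 + a1 * (?q x)\<^sup>2 + a2 * ?q x + a3 * f x)" for a0 a1 a2 a3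
    by (intro continuous_intros cont)
  have "S \<ge> 0"
    using E_mono[of "\<lambda>_. 0" "\<lambda>_. 1"] by (simp add: S_def E_def)
  moreover have "S \<noteq> 0"
  proof
    assume "S = 0"
    moreover have "continuous_on UNIV ?s"
      by (intro continuous_intros cont)
    moreover have "int_periodic ?s"
      using v(2) by (simp add: int_periodic_def)
    ultimately have "?s 0 = 0"
      by (intro torus_mean_eq_0D[of ?s 0]) (simp_all add: S_def E_def)
    then show False by simp
  qed
  ultimately have S: "S > 0" by simp

  \<comment> \<open>\<open>r\<close> is the scale of the gradient of \<open>v\<close>: the next two
    estimates bound its weighted second moment by a multiple of \<open>r\<^sup>2 * S\<close> and its
    first moment by a multiple of \<open>r * S\<close>.\<close>
  define r where "r = t * \<delta>"
  have r: "r > 0" "r \<le> 1" "r \<le> \<delta>" "\<delta>\<^sup>2 * t\<^sup>2 = r\<^sup>2" "r\<^sup>2 \<le> r"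
  proof -
    show "r > 0" "r \<le> 1" "r \<le> \<delta>" "\<delta>\<^sup>2 * t\<^sup>2 = r\<^sup>2"
      using t \<delta> by (simp_all add: r_def mult_le_one mult_left_le_one_le power_mult_distrib)
    then show "r\<^sup>2 \<le> r"
      by (simp add: power2_eq_square mult_left_le_one_le)
  qed

  \<comment> \<open>The energy identity, with \<open>c - t\<^sup>2\<close> at least
    \<open>- r\<^sup>2\<close> and the density \<open>?m\<close> between \<open>m0\<close> and
    \<open>m1\<close>.\<close>
  have "- (m1 * r\<^sup>2) * S + m0 * \<eta> + 0 * N + 0 * E f \<le> 0"
  proof -
    let ?g = "\<lambda>x. ?m x * (c - (norm p)\<^sup>2 + (?q x)\<^sup>2)"
    have "E (\<lambda>x. - (m1 * r\<^sup>2) + m0 * (?q x)\<^sup>2 + 0 * ?q x + 0 * f x) \<le> E ?g"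
    proof (rule E_mono[OF cont_comb])
      show "continuous_on UNIV ?g"
        by (intro continuous_intros cont)
      fix x
      have "m0 * (?q x)\<^sup>2 \<le> ?m x * (?q x)\<^sup>2"
        by (intro mult_right_mono m) simp
      moreover have "?m x * (t\<^sup>2 - c) \<le> ?m x * r\<^sup>2"
        using c r(4) by (intro mult_left_mono) (auto simp: abs_le_iff)
      moreover have "?m x * r\<^sup>2 \<le> m1 * r\<^sup>2"
        by (intro mult_right_mono m) simp
      ultimately show "- (m1 * r\<^sup>2) + m0 * (?q x)\<^sup>2 + 0 * ?q x + 0 * f x \<le> ?g x"
        unfolding p(1) by (simp add: algebra_simps)
    qed
    also have "E ?g = 0"
      using weighted_energy_identity[OF \<open>d > 0\<close> w0 w] unfolding v_def p_def E_def by simp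
    finally show ?thesis
      unfolding E_comb .
  qed
  then have \<eta>: "\<eta> \<le> C * r\<^sup>2 * S"
    using m_pos by (simp add: C_def field_simps)

  \<comment> \<open>Young's inequality with parameter \<open>r\<close> passes from the second moment
    to the first.\<close>
  have "N \<le> r / 2 * S + 1 / (2 * r) * \<eta> + 0 * N + 0 * E f"
  proof -
    have "?q x \<le> r / 2 + 1 / (2 * r) * (?q x)\<^sup>2 + 0 * ?q x + 0 * f x" for x
    proof -
      have "0 \<le> (?q x - r)\<^sup>2" by simp
      then have "2 * r * ?q x \<le> r\<^sup>2 + (?q x)\<^sup>2"
        by (simp add: power2_diff algebra_simps)
      then show ?thesis
        using r(1) by (simp add: field_simps power2_eq_square)
    qed
    then show ?thesis
      unfolding E_comb[symmetric] unfolding N_def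
      by (intro E_mono[OF _ cont_comb] continuous_intros cont)
  qed
  moreover have "1 / (2 * r) * \<eta> \<le> 1 / (2 * r) * (C * r\<^sup>2 * S)"
    using \<eta> r(1) by (intro mult_left_mono) auto
  moreover have "1 / (2 * r) * (C * r\<^sup>2 * S) = C / 2 * r * S"
    using r(1) by (simp add: field_simps power2_eq_square)
  moreover have "(1 + C) / 2 * r * S = r / 2 * S + C / 2 * r * S"
    by (simp add: field_simps)
  ultimately have N: "N \<le> (1 + C) / 2 * r * S"
    by linarith

  \<comment> \<open>Test function \<open>h\<close>: since
    \<open>p \<bullet> gradient w0 x = t * h x\<close>, it produces \<open>- 2 * t * f\<close>.
    \<open>B'\<close> collects the coefficients of the terms linear in the gradient of
    \<open>v\<close>.\<close>
  have "0 \<le> B * r\<^sup>2 * S + B * \<eta> + B' * N + (- 2 * t) * E f"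
  proof -
    let ?g = "\<lambda>x. h x * (c - (norm p)\<^sup>2 + (?q x)\<^sup>2 - 2 * (p \<bullet> gradient v x) - 2 * (p \<bullet> gradient w0 x)
      - 2 * (gradient w0 x \<bullet> gradient v x)) - d * (gradient h x \<bullet> gradient v x)"
    have "0 = E ?g"
      using weighted_cell_identity[OF \<open>d > 0\<close> w0 w h] unfolding v_def p_def E_def by simp
    also have "E ?g \<le> E (\<lambda>x. B * r\<^sup>2 + B * (?q x)\<^sup>2 + B' * ?q x + (- 2 * t) * f x)"
    proof (rule E_mono[OF _ cont_comb])
      show "continuous_on UNIV ?g"
        by (intro continuous_intros cont)
      fix x
      have "h x * (c - t\<^sup>2) \<le> B * r\<^sup>2"
        using mult_mono[OF hB[of x] c] B(1) r(4) by (metis abs_ge_self abs_ge_zero abs_mult less_imp_le order_trans)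
      moreover have "h x * (?q x)\<^sup>2 \<le> B * (?q x)\<^sup>2"
        using hB[of x] by (intro mult_right_mono) auto
      moreover have "- (h x * (p \<bullet> gradient v x)) \<le> B * ?q x"
      proof -
        have "\<bar>p \<bullet> gradient v x\<bar> \<le> 1 * ?q x"
          using Cauchy_Schwarz_ineq2[of p "gradient v x"] mult_right_mono[OF p(3) norm_ge_zero, of "gradient v x"] by linarith
        then have "\<bar>h x\<bar> * \<bar>p \<bullet> gradient v x\<bar> \<le> B * ?q x"
          using B(1) hB[of x] by (intro mult_mono) auto
        then show ?thesis
          by (metis abs_ge_minus_self abs_mult order_trans)
      qed
      moreover have "- (h x * (gradient w0 x \<bullet> gradient v x)) \<le> B\<^sup>2 * ?q x"
      proof -
        have "\<bar>gradient w0 x \<bullet> gradient v x\<bar> \<le> B * ?q x"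
          using Cauchy_Schwarz_ineq2[of "gradient w0 x" "gradient v x"] mult_right_mono[OF B(2)[of x] norm_ge_zero, of "gradient v x"]
          by linarith
        then have "\<bar>h x\<bar> * \<bar>gradient w0 x \<bullet> gradient v x\<bar> \<le> B * (B * ?q x)"
          using B(1) hB[of x] by (intro mult_mono) auto
        then show ?thesis
          by (metis abs_ge_minus_self abs_mult order_trans power2_eq_square mult.assoc)
      qed
      moreover have "- (d * (gradient h x \<bullet> gradient v x)) \<le> d * Bh * ?q x"
      proof -
        have "\<bar>gradient h x \<bullet> gradient v x\<bar> \<le> Bh * ?q x"
          using Cauchy_Schwarz_ineq2[of "gradient h x" "gradient v x"] mult_right_mono[OF Bh(2)[of x] norm_ge_zero, of "gradient v x"]
          by linarith
        then have "d * - (gradient h x \<bullet> gradient v x) \<le> d * (Bh * ?q x)"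
          using \<open>d > 0\<close> by (intro mult_left_mono) auto
        then show ?thesis by simp
      qed
      ultimately show "?g x \<le> B * r\<^sup>2 + B * (?q x)\<^sup>2 + B' * ?q x + (- 2 * t) * f x"
        unfolding p(1,2) by (simp add: B'_def f_def algebra_simps)
    qed
    finally show ?thesis
      unfolding E_comb .
  qed
  moreover have "B * \<eta> \<le> B * C * r * S"
  proof -
    have "C * r\<^sup>2 * S \<le> C * r * S"
      using C S r by (intro mult_right_mono mult_left_mono) auto
    with \<eta> have "B * \<eta> \<le> B * (C * r * S)"
      using B(1) by (intro mult_left_mono) auto
    then show ?thesis by (simp add: mult.assoc)
  qed
  moreover have "B * r\<^sup>2 * S \<le> B * r * S"
    using B S r by (intro mult_right_mono mult_left_mono) auto
  moreover have "B' * N \<le> B' * ((1 + C) / 2 * r * S)"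
    using N B' by (intro mult_left_mono)
  ultimately have "2 * t * E f \<le> (B + B * C + B' * ((1 + C) / 2)) * r * S"
    by (simp add: algebra_simps add_divide_distrib)
  \<comment> \<open>All errors are of order \<open>r = t * \<delta>\<close>, so dividing by
    \<open>t\<close> leaves the small factor \<open>\<delta>\<close>.\<close>
  then have "t * (2 * E f) \<le> t * ((B + B * C + B' * ((1 + C) / 2)) * \<delta> * S)"
    by (simp add: r_def ac_simps)
  then have Ef: "2 * E f \<le> (B + B * C + B' * ((1 + C) / 2)) * \<delta> * S"
    using t(1) by simp

  \<comment> \<open>The opposite bound: integrating the corrector by parts moves the derivative onto
    the weight, at a cost of \<open>D * N\<close>, so \<open>E f\<close> cannot be much smaller than
    \<open>\<kappa> / 2 * S\<close>.\<close>
  have "\<kappa> / 2 * S + 0 * \<eta> + (- D) * N + (- 1) * E f \<le> 0"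
  proof -
    let ?g = "\<lambda>x. \<xi> \<bullet> gradient W x + - (2 / d) * W x * (\<xi> \<bullet> gradient v x)"
    have "E (\<lambda>x. \<kappa> / 2 + 0 * (?q x)\<^sup>2 + (- D) * ?q x + (- 1) * f x) \<le> E ?g"
    proof (rule E_mono[OF cont_comb])
      show "continuous_on UNIV ?g"
        by (intro continuous_intros cont)
      fix x
      have "\<bar>\<xi> \<bullet> gradient v x\<bar> \<le> norm \<xi> * ?q x"
        by (rule Cauchy_Schwarz_ineq2)
      then have "\<bar>W x\<bar> * \<bar>\<xi> \<bullet> gradient v x\<bar> \<le> BW * (norm \<xi> * ?q x)"
        using BW(1) BW(2)[of x] by (intro mult_mono) auto
      then have "W x * (\<xi> \<bullet> gradient v x) \<le> BW * (norm \<xi> * ?q x)"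
        by (metis abs_ge_self abs_mult order_trans)
      then have "(2 / d) * (W x * (\<xi> \<bullet> gradient v x)) \<le> (2 / d) * (BW * (norm \<xi> * ?q x))"
        using \<open>d > 0\<close> by (intro mult_left_mono) auto
      then have "(2 / d) * W x * (\<xi> \<bullet> gradient v x) \<le> D * ?q x"
        by (simp only: D_def mult.assoc)
      then show "\<kappa> / 2 + 0 * (?q x)\<^sup>2 + (- D) * ?q x + (- 1) * f x \<le> ?g x"
        using abs_ge_minus_self[of "\<xi> \<bullet> gradient W x + f x - \<kappa>"] W(3)[of x]
        by (simp only: mult_minus_left mult_zero_left mult_1_left)
    qed
    also have "E ?g = 0"
      unfolding E_def by (rule torus_mean_exp_gradient[OF Ck_lower[OF v(1), unfolded One_nat_def] v(2) W(1,2)])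
    finally show ?thesis
      unfolding E_comb .
  qed
  moreover have "D * N \<le> D * ((1 + C) / 2 * \<delta> * S)"
  proof -
    have "(1 + C) / 2 * r * S \<le> (1 + C) / 2 * \<delta> * S"
      using C S r by (intro mult_right_mono mult_left_mono) auto
    with N D show ?thesis
      by (intro mult_left_mono) auto
  qed
  ultimately have "\<kappa> / 2 * S \<le> \<delta> * A * S"
    using Ef unfolding A_def by (simp add: algebra_simps add_divide_distrib)
  with S \<delta>(3) show False
    by simp
qed

lemma potential_eq_0_of_quadratic_expansion:
  fixes V :: "real^'n \<Rightarrow> real"
  assumes "d > 0"
    and sol: "\<And>p. \<exists>w. cell_solution d (\<lambda>p. (norm p)\<^sup>2) V p (Hbar p) w"
    and o: "(\<lambda>p. Hbar p - (norm p)\<^sup>2) \<in> o[at 0](\<lambda>p. (norm p)\<^sup>2)"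
  shows "V x = 0"
proof -
  obtain w0 where w0: "cell_solution d (\<lambda>p. (norm p)\<^sup>2) V 0 (Hbar 0) w0"
    using sol by blast
  then have w0': "Ck 2 w0" "Ck (Suc 1) w0" "int_periodic w0"
      "\<And>x. - d * laplacian w0 x + (norm (gradient w0 x))\<^sup>2 + V x = Hbar 0"
    by (auto simp: cell_solution_def Ck_2 simp del: Ck.simps)
  obtain B where B: "B > 0" "\<And>x. norm (gradient w0 x) \<le> B"
    using periodic_bounded[OF continuous_on_gradient[OF w0'(2)] int_periodic_gradient[OF w0'(3)]] by blast
  have near: "\<exists>e>0. \<forall>t. 0 < t \<and> t < e \<longrightarrow> \<bar>Hbar (t *\<^sub>R axis i 1) - t\<^sup>2\<bar> \<le> a * t\<^sup>2" if "a > 0" for a i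
  proof -
    have "eventually (\<lambda>p. norm (Hbar p - (norm p)\<^sup>2) \<le> a * norm ((norm p)\<^sup>2)) (at 0)"
      using landau_o.smallD[OF o that] .
    then obtain e where e: "e > 0"
      "\<And>p. p \<noteq> 0 \<Longrightarrow> norm p < e \<Longrightarrow> \<bar>Hbar p - (norm p)\<^sup>2\<bar> \<le> a * (norm p)\<^sup>2"
      by (auto simp: eventually_at)
    have "\<bar>Hbar (t *\<^sub>R axis i 1) - t\<^sup>2\<bar> \<le> a * t\<^sup>2" if "0 < t" "t < e" for t
      using e(2)[of "t *\<^sub>R axis i 1"] that by (simp add: axis_eq_0_iff)
    with e(1) show ?thesis by blast
  qed
  \<comment> \<open>The expansion concerns only nonzero \<open>p\<close>; the value at 0 is reached
    by continuity. Comparing \<open>w0\<close> with \<open>w\<close> in both directions gives the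
    two bounds.\<close>
  have cont: "\<bar>Hbar p - Hbar 0\<bar> \<le> 2 * norm p * B + (norm p)\<^sup>2" for p
  proof -
    obtain w where w: "Ck 2 w" "int_periodic w"
        "\<And>x. - d * laplacian w x + (norm (p + gradient w x))\<^sup>2 + V x = Hbar p"
      using sol[of p] by (auto simp: cell_solution_def simp del: Ck.simps)
    have inner: "\<bar>p \<bullet> gradient w0 x\<bar> \<le> norm p * B" for x
      using Cauchy_Schwarz_ineq2[of p "gradient w0 x"] mult_left_mono[OF B(2)[of x], of "norm p"] by simp
    have expand: "(norm (p + gradient w0 x))\<^sup>2 =
        (norm p)\<^sup>2 + 2 * (p \<bullet> gradient w0 x) + (norm (gradient w0 x))\<^sup>2" for x
      by (simp only: power2_norm_eq_inner) (simp add: algebra_simps inner_commute)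
    obtain x where x: "gradient w0 x = gradient w x" "laplacian w0 x \<le> laplacian w x"
      using periodic_comparison[OF w0'(1,3) w(1,2)] by blast
    obtain y where y: "gradient w y = gradient w0 y" "laplacian w y \<le> laplacian w0 y"
      using periodic_comparison[OF w(1,2) w0'(1,3)] by blast
    have "d * laplacian w0 x \<le> d * laplacian w x" "d * laplacian w y \<le> d * laplacian w0 y"
      using x y \<open>d > 0\<close> by simp_all
    then have "Hbar p - Hbar 0 \<le> (norm p)\<^sup>2 + 2 * (p \<bullet> gradient w0 x)"
        "Hbar p - Hbar 0 \<ge> (norm p)\<^sup>2 + 2 * (p \<bullet> gradient w0 y)"
      using w(3)[of x] w(3)[of y] w0'(4)[of x] w0'(4)[of y] expand[of x] expand[of y] x(1) y(1) by simp_all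
    then show ?thesis
      using inner[of x] inner[of y] zero_le_power2[of "norm p"] by linarith
  qed
  have "\<bar>Hbar 0\<bar> \<le> 0"
  proof (rule field_le_epsilon)
    fix e :: real assume "e > 0"
    fix i :: 'n
    obtain e' where e': "e' > 0" "\<And>t. 0 < t \<Longrightarrow> t < e' \<Longrightarrow> \<bar>Hbar (t *\<^sub>R axis i 1) - t\<^sup>2\<bar> \<le> 1 * t\<^sup>2"
      using near[of 1 i] by auto
    \<comment> \<open>The denominator gathers \<open>2 * B\<close> from the continuity bound and 3
      from three squares of \<open>t\<close>: one in that bound, one in the expansion and
      \<open>norm p\<close> squared itself.\<close>
    define t where "t = min (min 1 (e' / 2)) (e / (2 * B + 3))"
    have t: "0 < t" "t < e'" "t \<le> 1" "t \<le> e / (2 * B + 3)"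
      using \<open>e > 0\<close> e'(1) B(1) by (auto simp: t_def)
    have "t\<^sup>2 \<le> t"
      using t by (simp add: power2_eq_square mult_left_le_one_le)
    moreover have "\<bar>Hbar (t *\<^sub>R axis i 1) - Hbar 0\<bar> \<le> 2 * t * B + t\<^sup>2"
      using cont[of "t *\<^sub>R axis i 1"] t(1) by simp
    ultimately have "\<bar>Hbar 0\<bar> \<le> t * (2 * B + 3)"
      using e'(2)[OF t(1,2)] by (simp add: algebra_simps abs_le_iff)
    moreover have "t * (2 * B + 3) \<le> e"
      using t(4) B(1) by (simp add: pos_le_divide_eq)
    ultimately show "\<bar>Hbar 0\<bar> \<le> 0 + e" by simp
  qed
  then have "Hbar 0 = 0" by simp
  with w0 have w00: "cell_solution d (\<lambda>p. (norm p)\<^sup>2) V 0 0 w0" by simp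
  have "partial_deriv i w0 y = 0" for i y
  proof (rule cell_solution_partial_deriv_eq_0[OF \<open>d > 0\<close> w00])
    fix \<delta> :: real assume "0 < \<delta>" "\<delta> \<le> 1"
    then obtain e where e: "e > 0" "\<And>t. 0 < t \<Longrightarrow> t < e \<Longrightarrow> \<bar>Hbar (t *\<^sub>R axis i 1) - t\<^sup>2\<bar> \<le> \<delta>\<^sup>2 * t\<^sup>2"
      using near[of "\<delta>\<^sup>2" i] by auto
    define t where "t = min 1 (e / 2)"
    have "0 < t" "t \<le> 1" "t < e"
      using e(1) by (auto simp: t_def)
    with e(2)[of t] sol[of "t *\<^sub>R axis i 1"]
    show "\<exists>t c w. 0 < t \<and> t \<le> 1 \<and>
      cell_solution d (\<lambda>p. (norm p)\<^sup>2) V (t *\<^sub>R axis i 1) c w \<and> \<bar>c - t\<^sup>2\<bar> \<le> \<delta>\<^sup>2 * t\<^sup>2"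
      by blast
  qed
  then have grad: "gradient w0 y = 0" for y
    by (simp add: vec_eq_iff)
  then show ?thesis
    using w0'(4)[of x] laplacian_eq_0_of_gradient[of w0 x] \<open>Hbar 0 = 0\<close> by simp
qed

theorem theorem1p5:
  fixes d :: real and V :: "real^'n \<Rightarrow> real"
  assumes "d > 0" and "Cinfinity V" and "int_periodic V"
  shows
    "(\<forall>(H :: real^'n \<Rightarrow> real) Hbar.
        Ck 2 H \<longrightarrow>
        bdd_above (range (\<lambda>p. onorm ((*v) (hessian H p)))) \<longrightarrow>
        superlinear H \<longrightarrow>
        viscous_effective_hamiltonian d H V Hbar \<longrightarrow>
        (\<forall>p. Hbar p = H p) \<longrightarrow> (\<forall>x. V x = 0))
     \<and>
     (\<forall>Hbar.
        viscous_effective_hamiltonian d (\<lambda>p. (norm p)\<^sup>2) V Hbar \<longrightarrow>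
        (\<lambda>p. Hbar p - (norm p)\<^sup>2) \<in> o[at 0](\<lambda>p. (norm p)\<^sup>2) \<longrightarrow>
        (\<forall>x. V x = 0))"
proof (intro conjI allI impI)
  fix H :: "real^'n \<Rightarrow> real" and Hbar x
  assume H: "Ck 2 H" "bdd_above (range (\<lambda>p. onorm ((*v) (hessian H p))))" "superlinear H"
    and eff: "viscous_effective_hamiltonian d H V Hbar" "\<forall>p. Hbar p = H p"
  have "\<exists>w. cell_solution d H V p (H p) w" for p
    using eff unfolding viscous_effective_hamiltonian_def by metis
  moreover have "Ck 2 V"
    using assms(2) unfolding Cinfinity_def by blast
  ultimately show "V x = 0"
    using potential_eq_0_of_bounded_hessian[OF assms(1) _ assms(3) H] by blast
next
  fix Hbar x
  assume eff: "viscous_effective_hamiltonian d (\<lambda>p. (norm p)\<^sup>2) V Hbar"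
    and "(\<lambda>p. Hbar p - (norm p)\<^sup>2) \<in> o[at 0](\<lambda>p. (norm p)\<^sup>2)"
  moreover have "\<exists>w. cell_solution d (\<lambda>p. (norm p)\<^sup>2) V p (Hbar p) w" for p
    using eff unfolding viscous_effective_hamiltonian_def by blast
  ultimately show "V x = 0"
    using potential_eq_0_of_quadratic_expansion[OF assms(1)] by blast
qed

end
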